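(* If $xPy$ is a valid formula of the $(\{\mathbf{1},\cup,\cap\};\_)$-fragment of $\mathsf{RL}(\mathbf{1})$, then the dual tableau procedure (described in the context), started on the initial deduction tree for $xPy$, yields a closed proof tree for $xPy$.
   Context: **Syntax and semantics.** Let $\mathbb{RV}$ be a countably infinite set of relational variables $\mathsf{r},\mathsf{s},\dots$, $\mathbf{1}$ a relational constant, $\mathbb{OV}$ a countably infinite set of object variables. A formula is an expression $xRy$ with $x,y\in\mathbb{OV}$ and $R$ a relational term. Only terms built with $-$ (complement), $\cup$, $\cap$, $;$ (composition) are needed here. A Boolean term is one involving only $-,\cup,\cap$. A literal is a formula $x\mathsf{r}y$, $x\mathbf{1}y$, $x(-\mathsf{r})y$ or $x(-\mathbf{1})y$. A model is $\mathcal{M}=(U,m)$ with $U\neq\emptyset$ and $m:\mathbb{RV}\to\wp(U\times U)$, extended by $m(\mathbf{1})=U\times U$, $m(-R)=(U\times U)\setminus m(R)$, $m(R\cup S)=m(R)\cup m(S)$, $m(R\cap S)=m(R)\cap m(S)$, $m(R;S)=\{(a,b):\exists c\in U,\ (a,c)\in m(R),(c,b)\in m(S)\}$. A valuation is $v:\mathbb{OV}\to U$; $\mathcal{M},v\models xRy$ iff $(v(x),v(y))\in m(R)$. A formula is valid if satisfied by all models and all valuations in them. **The fragment.** The $(\{\mathbf{1},\cup,\cap\};\_)$-fragment consists of the formulae $xPy$ with $P\in\mathbb{RT}_0$, where $\mathbb{RT}_0$ is the smallest set of terms containing $\mathbf{1}$ and all relational variables such that: if $P,Q,B,H\in\mathbb{RT}_0$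 and $S\in\{H,\mathbf{1}\}$, with $B$ a Boolean term containing neither $\mathbf{1}$ nor $-$, and $H$ containing $\mathbf{1}$ only inside terms of the form $(B';\mathbf{1})$ ($B'$ Boolean without $\mathbf{1}$ and $-$), then $(-P),(P\cup Q),(P\cap Q),(B;S),(\mathbf{1};S)\in\mathbb{RT}_0$. Below, $B$, $B_1$ always denote Boolean terms without $\mathbf{1}$ and $-$. **Bool-constructions.** The complement normal form $\mathsf{nf}_-(R)$ of a Boolean term $R$ is obtained by pushing complements inside by the De Morgan laws and double negation: it fixes $\mathbf{1}$, $-\mathbf{1}$, $\mathsf{s}$, $-\mathsf{s}$, commutes with $\cup$ and $\cap$, and $\mathsf{nf}_-(-(S\cap H))=\mathsf{nf}_-(-S)\cup\mathsf{nf}_-(-H)$, $\mathsf{nf}_-(-(S\cup H))=\mathsf{nf}_-(-S)\cap\mathsf{nf}_-(-H)$, $\mathsf{nf}_-(--S)=\mathsf{nf}_-(S)$. For a set $N$ of formulae, the $\mathsf{Bool}_N$-formulae are defined by: every literal in $N$ is a $\mathsf{Bool}_N$-formula; $x(R\cap S)y$ is a $\mathsf{Bool}_N$-formula if one of $xRy$, $xSy$ is a $\mathsf{Bool}_N$-formula and the term of the other is in complement normal form; $x(R\cup S)y$ is a $\mathsf{Bool}_N$-formula if both $xRy$ and $xSy$ are. The formula $xRy$ has a Bool-construction from $N$ if $x\,\mathsf{nf}_-(R)\,y$ is a $\mathsf{Bool}_N$-formula. $V(R,x,N)$ is the set of object variables $z$ such that $xRz$ has a Bool-construction from $N$. **Deduction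 trees.** Nodes are labelled by (disjunctive) finite sets of formulae. A set is axiomatic if it contains some $uRw$ together with $u(-R)w$, or some $u\mathbf{1}w$. For a branch $\theta$, $\bigcup\theta$ is the set of all formulae in its nodes and $W_\theta$ the set of object variables occurring in them. A branch is axiomatic (closed) if one of its nodes is; a tree is closed if all its branches are closed. The initial deduction tree for $xPy$ is the single node $\{xPy\}$. A deduction tree is extended at a non-axiomatic leaf $N$ of a branch $\theta$ by choosing $\varphi\in N$ and a rule for $\varphi$, and appending for each conclusion set $\Gamma$ (several sets are separated by $|$, giving branching) the node $(N\setminus\{\varphi\})\cup\Gamma$. The rules are: - Boolean rules: $u(R\cup S)w\leadsto uRw,uSw$; $u(-(R\cup S))w\leadsto u(-R)w\,|\,u(-S)w$; $u(R\cap S)w\leadsto uRw\,|\,uSw$; $u(-(R\cap S))w\leadsto u(-R)w,u(-S)w$; $u(--R)w\leadsto uRw$. - $(-;)$-rules, with $z$ a new object variable: $u(-(B;S))y\leadsto u(-B)z,\ z(-S)y$ if $S\ne\mathbf{1}$; $u(-(B;\mathbf{1}))y\leadsto u(-B)z$; $x(-(\mathbf{1};S))y\leadsto z(-S)y$ if $S\neq\mathbf{1}$, applied only if the branch contains no formula $z'(-S)y$ with $z'$ a new variable (i.e. introduced by a rule). The formula $x(-(\mathbf{1};\mathbf{1}))y$ is not decomposed. - $(;)_a$: $u(B;S)y\leadsto zSy,\ u(B;S)y$ with $z\in V(-B,u,\bigcup\theta)$. - $(;)_b$: $x(\mathbf{1};S)y\leadsto zSy,\ x(\mathbf{1};S)y$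 with $z$ any variable already occurring, provided $zSy$ is not already in the branch. **Order on variables.** A variable $z\in W_\theta\setminus\{x,y\}$ is a descendant (of degree 1) of $w$ if $z$ was introduced by decomposing a formula $w(-(B;S))y$; descendants of higher degree are obtained by iterating. $<_\theta$ is a total order on $W_\theta$ such that $x$ is least; variables in $W_\theta\setminus\{x,y\}$ are ordered by time of introduction; $y<_\theta z$ for every descendant $z$ of $y$; and $w<_\theta y$ for every $w\ne y$ that is not a descendant of $y$. **Blocking.** In a branch $\theta$, $z'(-(B;S))y$ blocks $z(-(B;S))y$ (same $B,S,y$, different left variable) if $z'(-(B;S))y$ has already been decomposed in $\theta$, using the new variable $w$, and for every formula $z(B_1;Q)y$ occurring in $\theta$ such that $z(-B_1)w$ has a Bool-construction from the set of literals that result from the Boolean decomposition of $z(-B)w$ (i.e. the literals $z(-\mathsf{r})w$ corresponding to the literals $z'(-\mathsf{r})w$ obtained in $\theta$ from $z'(-B)w$), the formula $z'(B_1;Q)y$ occurs in $\theta$ as well. **Procedure.** Start from the initial deduction tree for $xPy$. 1. Consider each non-axiomatic branch $\theta$ of the current deduction tree. 2. While $\theta$ is non-axiomatic and further expandable (some rule application permitted below is still possible), let $z$ be the $<_\theta$-smallest variable for which some permitted decomposition is still outstanding (a formula with left variable $z$ not yet decomposed, or a formula $x(\mathbf{1};S)y$ not yet decomposed with $z$). Apply to the formulae with left variable $z$ the rules in this order: Boolean rules, $(-;)$-rules, $(;)_a$; then apply $(;)_b$ to the formulae $x(\mathbf{1};S)y$ in $\theta$ with the variable $z$, until saturation. Requirements: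 (a) each rule is applied at most once with the same premise (for $(;)_a$ and $(;)_b$: the same premise and the same variable $z$); (b) a formula $z(-(B;S))y$ is not decomposed if it is blocked by some $z'(-(B;S))y$ occurring in $\theta$. 3. If $\theta$ is axiomatic and all other branches are axiomatic, stop: the current tree is a (closed) proof tree for $xPy$. If $\theta$ is axiomatic and there are still non-axiomatic branches, return to step 1. 4. Otherwise $\theta$ is a non-axiomatic, not further expandable branch: stop and return $\theta$ (together with a model and a valuation directly read off from $\theta$). *)

theory Defs
  imports Main
begin

section \<open>Syntax and semantics\<close>

type_synonym rvar = nat
type_synonym ovar = nat

datatype rterm =
    RVar rvar
  | One
  | Neg rterm
  | Cup rterm rterm
  | Cap rterm rterm
  | Comp rterm rterm

datatype fmla = Fm (lvar: ovar) (rel: rterm) (rvar: ovar)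

fun is_literal :: "fmla \<Rightarrow> bool" where
  "is_literal (Fm x (RVar r) y) = True"
| "is_literal (Fm x One y) = True"
| "is_literal (Fm x (Neg (RVar r)) y) = True"
| "is_literal (Fm x (Neg One) y) = True"
| "is_literal _ = False"

primrec interp :: "'u set \<Rightarrow> (rvar \<Rightarrow> ('u \<times> 'u) set) \<Rightarrow> rterm \<Rightarrow> ('u \<times> 'u) set" where
  "interp U m (RVar r) = m r"
| "interp U m One = U \<times> U"
| "interp U m (Neg R) = (U \<times> U) - interp U m R"
| "interp U m (Cup R S) = interp U m R \<union> interp U m S"
| "interp U m (Cap R S) = interp U m R \<inter> interp U m S"
| "interp U m (Comp R S) =
     {(a, b). \<exists>c\<in>U. (a, c) \<in> interp U m R \<and> (c, b) \<in> interp U m S}"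

definition is_model :: "'u set \<Rightarrow> (rvar \<Rightarrow> ('u \<times> 'u) set) \<Rightarrow> bool" where
  "is_model U m \<longleftrightarrow> U \<noteq> {} \<and> (\<forall>r. m r \<subseteq> U \<times> U)"

definition is_valuation :: "'u set \<Rightarrow> (ovar \<Rightarrow> 'u) \<Rightarrow> bool" where
  "is_valuation U v \<longleftrightarrow> (\<forall>z. v z \<in> U)"

definition satisfies ::
  "'u set \<Rightarrow> (rvar \<Rightarrow> ('u \<times> 'u) set) \<Rightarrow> (ovar \<Rightarrow> 'u) \<Rightarrow> fmla \<Rightarrow> bool" where
  "satisfies U m v \<phi> \<longleftrightarrow> (v (lvar \<phi>), v (rvar \<phi>)) \<in> interp U m (rel \<phi>)"

text \<open>HOL cannot quantify over types inside a formula, so validity refers to all models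
  whose universe is a nonempty subset of a given type.\<close>

definition valid :: "'u itself \<Rightarrow> fmla \<Rightarrow> bool" where
  "valid _ \<phi> \<longleftrightarrow>
     (\<forall>(U :: 'u set) m v. is_model U m \<longrightarrow> is_valuation U v \<longrightarrow> satisfies U m v \<phi>)"


section \<open>The fragment\<close>

text \<open>Boolean terms containing neither the constant 1 nor complement.\<close>

fun pos_bool :: "rterm \<Rightarrow> bool" where
  "pos_bool (RVar r) = True"
| "pos_bool One = False"
| "pos_bool (Neg R) = False"
| "pos_bool (Cup R S) = (pos_bool R \<and> pos_bool S)"
| "pos_bool (Cap R S) = (pos_bool R \<and> pos_bool S)"
| "pos_bool (Comp R S) = False"

text \<open>The constant 1 occurs only inside subterms \<open>Comp B One\<close> with \<open>pos_bool B\<close>.\<close>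

fun one_guarded :: "rterm \<Rightarrow> bool" where
  "one_guarded (RVar r) = True"
| "one_guarded One = False"
| "one_guarded (Neg R) = one_guarded R"
| "one_guarded (Cup R S) = (one_guarded R \<and> one_guarded S)"
| "one_guarded (Cap R S) = (one_guarded R \<and> one_guarded S)"
| "one_guarded (Comp R S) = (pos_bool R \<and> S = One \<or> one_guarded R \<and> one_guarded S)"

inductive_set RT0 :: "rterm set" where
  "One \<in> RT0"
| "RVar r \<in> RT0"
| "P \<in> RT0 \<Longrightarrow> Neg P \<in> RT0"
| "P \<in> RT0 \<Longrightarrow> Q \<in> RT0 \<Longrightarrow> Cup P Q \<in> RT0"
| "P \<in> RT0 \<Longrightarrow> Q \<in> RT0 \<Longrightarrow> Cap P Q \<in> RT0"
| "B \<in> RT0 \<Longrightarrow> pos_bool B \<Longrightarrow> H \<in> RT0 \<Longrightarrow> one_guarded H \<Longrightarrow> Comp B H \<in> RT0"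
| "B \<in> RT0 \<Longrightarrow> pos_bool B \<Longrightarrow> Comp B One \<in> RT0"
| "H \<in> RT0 \<Longrightarrow> one_guarded H \<Longrightarrow> Comp One H \<in> RT0"
| "Comp One One \<in> RT0"


section \<open>Bool-constructions\<close>

text \<open>Complement normal form. It is meant for Boolean terms only; the values at compositions
  are dummies, and never give rise to a Bool-construction.\<close>

fun nf :: "rterm \<Rightarrow> rterm" where
  "nf One = One"
| "nf (RVar s) = RVar s"
| "nf (Cup S H) = Cup (nf S) (nf H)"
| "nf (Cap S H) = Cap (nf S) (nf H)"
| "nf (Comp S H) = Comp S H"
| "nf (Neg One) = Neg One"
| "nf (Neg (RVar s)) = Neg (RVar s)"
| "nf (Neg (Cap S H)) = Cup (nf (Neg S)) (nf (Neg H))"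
| "nf (Neg (Cup S H)) = Cap (nf (Neg S)) (nf (Neg H))"
| "nf (Neg (Neg S)) = nf S"
| "nf (Neg (Comp S H)) = Neg (Comp S H)"

fun is_cnf :: "rterm \<Rightarrow> bool" where
  "is_cnf One = True"
| "is_cnf (RVar r) = True"
| "is_cnf (Neg One) = True"
| "is_cnf (Neg (RVar r)) = True"
| "is_cnf (Cup R S) = (is_cnf R \<and> is_cnf S)"
| "is_cnf (Cap R S) = (is_cnf R \<and> is_cnf S)"
| "is_cnf _ = False"

inductive_set Bool_fm :: "fmla set \<Rightarrow> fmla set" for N :: "fmla set" where
  "\<phi> \<in> N \<Longrightarrow> is_literal \<phi> \<Longrightarrow> \<phi> \<in> Bool_fm N"
| "Fm x R y \<in> Bool_fm N \<Longrightarrow> is_cnf S \<Longrightarrow> Fm x (Cap R S) y \<in> Bool_fm N"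
| "Fm x S y \<in> Bool_fm N \<Longrightarrow> is_cnf R \<Longrightarrow> Fm x (Cap R S) y \<in> Bool_fm N"
| "Fm x R y \<in> Bool_fm N \<Longrightarrow> Fm x S y \<in> Bool_fm N \<Longrightarrow> Fm x (Cup R S) y \<in> Bool_fm N"

definition bool_constr :: "fmla set \<Rightarrow> fmla \<Rightarrow> bool" where
  "bool_constr N \<phi> \<longleftrightarrow> Fm (lvar \<phi>) (nf (rel \<phi>)) (rvar \<phi>) \<in> Bool_fm N"

definition V :: "rterm \<Rightarrow> ovar \<Rightarrow> fmla set \<Rightarrow> ovar set" where
  "V R x N = {z. bool_constr N (Fm x R z)}"


section \<open>Deduction trees\<close>

text \<open>The argument of \<open>NegComp\<close> is the new variable introduced; the argument of \<open>CompA\<close>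
  and \<open>CompB\<close> is the variable with which the premise is decomposed.\<close>

datatype rule = Boolean | NegComp ovar | CompA ovar | CompB ovar

type_synonym app = "rule \<times> fmla"

text \<open>Inner nodes carry the rule application performed there. The nodes of a branch are listed
  from the root to the leaf, and so are the rule applications along it.\<close>

datatype dtree = Leaf "fmla set" | Step "fmla set" app "dtree list"

datatype branch = Branch (nodes: "fmla set list") (steps: "app list")

text \<open>\<open>branch_at t p\<close> is the branch of \<open>t\<close> that ends in the leaf at position \<open>p\<close>
  (a list of child indices), if there is such a leaf.\<close>

fun branch_at :: "dtree \<Rightarrow> nat list \<Rightarrow> branch option" where
  "branch_at (Leaf N) [] = Some (Branch [N] [])"
| "branch_at (Step N a ts) (i # p) =
     (if i < length ts
      then map_option (\<lambda>\<theta>. Branch (N # nodes \<theta>) (a # steps \<theta>)) (branch_at (ts ! i) p)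
      else None)"
| "branch_at _ _ = None"

fun extend_at :: "dtree \<Rightarrow> nat list \<Rightarrow> app \<Rightarrow> fmla set list \<Rightarrow> dtree" where
  "extend_at (Leaf N) [] a Ns = Step N a (map Leaf Ns)"
| "extend_at (Step N b ts) (i # p) a Ns = Step N b (ts[i := extend_at (ts ! i) p a Ns])"
| "extend_at t _ _ _ = t"

definition leaf :: "branch \<Rightarrow> fmla set" where
  "leaf \<theta> = last (nodes \<theta>)"

definition forms :: "branch \<Rightarrow> fmla set" where
  "forms \<theta> = \<Union> (set (nodes \<theta>))"

definition vars :: "branch \<Rightarrow> ovar set" where
  "vars \<theta> = lvar ` forms \<theta> \<union> rvar ` forms \<theta>"

definition new_vars :: "branch \<Rightarrow> ovar list" where
  "new_vars \<theta> = [z. (NegComp z, \<phi>) \<leftarrow> steps \<theta>]"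

definition axiomatic_set :: "fmla set \<Rightarrow> bool" where
  "axiomatic_set N \<longleftrightarrow>
     (\<exists>u R w. Fm u R w \<in> N \<and> Fm u (Neg R) w \<in> N) \<or> (\<exists>u w. Fm u One w \<in> N)"

definition axiomatic :: "branch \<Rightarrow> bool" where
  "axiomatic \<theta> \<longleftrightarrow> (\<exists>N \<in> set (nodes \<theta>). axiomatic_set N)"

definition closed_tree :: "dtree \<Rightarrow> bool" where
  "closed_tree t \<longleftrightarrow> (\<forall>p \<theta>. branch_at t p = Some \<theta> \<longrightarrow> axiomatic \<theta>)"

text \<open>\<open>decomposes x y r \<phi> \<Gamma>s\<close>: rule \<open>r\<close> decomposes \<open>\<phi>\<close> into the alternatives \<open>\<Gamma>s\<close>, where
  \<open>x\<close> and \<open>y\<close> are the variables of the formula at the root.\<close>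

inductive decomposes :: "ovar \<Rightarrow> ovar \<Rightarrow> rule \<Rightarrow> fmla \<Rightarrow> fmla set list \<Rightarrow> bool"
  for x y :: ovar where
  "decomposes x y Boolean (Fm u (Cup R S) w) [{Fm u R w, Fm u S w}]"
| "decomposes x y Boolean (Fm u (Neg (Cup R S)) w) [{Fm u (Neg R) w}, {Fm u (Neg S) w}]"
| "decomposes x y Boolean (Fm u (Cap R S) w) [{Fm u R w}, {Fm u S w}]"
| "decomposes x y Boolean (Fm u (Neg (Cap R S)) w) [{Fm u (Neg R) w, Fm u (Neg S) w}]"
| "decomposes x y Boolean (Fm u (Neg (Neg R)) w) [{Fm u R w}]"
| "pos_bool B \<Longrightarrow> S \<noteq> One \<Longrightarrow>
   decomposes x y (NegComp z) (Fm u (Neg (Comp B S)) y) [{Fm u (Neg B) z, Fm z (Neg S) y}]"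
| "pos_bool B \<Longrightarrow>
   decomposes x y (NegComp z) (Fm u (Neg (Comp B One)) y) [{Fm u (Neg B) z}]"
| "S \<noteq> One \<Longrightarrow>
   decomposes x y (NegComp z) (Fm x (Neg (Comp One S)) y) [{Fm z (Neg S) y}]"
| "pos_bool B \<Longrightarrow>
   decomposes x y (CompA z) (Fm u (Comp B S) y) [{Fm z S y, Fm u (Comp B S) y}]"
| "decomposes x y (CompB z) (Fm x (Comp One S) y) [{Fm z S y, Fm x (Comp One S) y}]"

fun side_condition :: "branch \<Rightarrow> app \<Rightarrow> bool" where
  "side_condition \<theta> (Boolean, _) = True"
| "side_condition \<theta> (NegComp z, Fm u (Neg (Comp R S)) y) =
     (z \<notin> vars \<theta> \<and>
      (R = One \<longrightarrow> \<not> (\<exists>z' \<in> set (new_vars \<theta>). Fm z' (Neg S) y \<in> forms \<theta>)))"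
| "side_condition \<theta> (CompA z, Fm u (Comp B S) y) = (z \<in> V (Neg B) u (forms \<theta>))"
| "side_condition \<theta> (CompB z, Fm u (Comp R S) y) = (z \<in> vars \<theta> \<and> Fm z S y \<notin> forms \<theta>)"
| "side_condition \<theta> _ = False"

definition applicable :: "ovar \<Rightarrow> ovar \<Rightarrow> branch \<Rightarrow> app \<Rightarrow> fmla set list \<Rightarrow> bool" where
  "applicable x y \<theta> a \<Gamma>s \<longleftrightarrow>
     snd a \<in> leaf \<theta> \<and> decomposes x y (fst a) (snd a) \<Gamma>s \<and> side_condition \<theta> a"

definition apply_at :: "dtree \<Rightarrow> nat list \<Rightarrow> branch \<Rightarrow> app \<Rightarrow> fmla set list \<Rightarrow> dtree" where
  "apply_at t p \<theta> a \<Gamma>s = extend_at t p a (map (\<lambda>\<Gamma>. (leaf \<theta> - {snd a}) \<union> \<Gamma>) \<Gamma>s)"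

definition initial_tree :: "fmla \<Rightarrow> dtree" where
  "initial_tree \<phi> = Leaf {\<phi>}"

inductive deduction_tree :: "fmla \<Rightarrow> dtree \<Rightarrow> bool" for \<phi> :: fmla where
  "deduction_tree \<phi> (initial_tree \<phi>)"
| "deduction_tree \<phi> t \<Longrightarrow> branch_at t p = Some \<theta> \<Longrightarrow> \<not> axiomatic_set (leaf \<theta>) \<Longrightarrow>
   applicable (lvar \<phi>) (rvar \<phi>) \<theta> a \<Gamma>s \<Longrightarrow> deduction_tree \<phi> (apply_at t p \<theta> a \<Gamma>s)"

definition proof_tree :: "fmla \<Rightarrow> dtree \<Rightarrow> bool" where
  "proof_tree \<phi> t \<longleftrightarrow> deduction_tree \<phi> t \<and> closed_tree t"


section \<open>Order on variables\<close>

definition child_rel :: "ovar \<Rightarrow> branch \<Rightarrow> (ovar \<times> ovar) set" where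
  "child_rel y \<theta> =
     {(z, w). \<exists>B S. pos_bool B \<and> (NegComp z, Fm w (Neg (Comp B S)) y) \<in> set (steps \<theta>)}"

definition descendant :: "ovar \<Rightarrow> branch \<Rightarrow> ovar \<Rightarrow> ovar \<Rightarrow> bool" where
  "descendant y \<theta> z w \<longleftrightarrow> (z, w) \<in> (child_rel y \<theta>)\<^sup>+"

definition introduced_before :: "branch \<Rightarrow> ovar \<Rightarrow> ovar \<Rightarrow> bool" where
  "introduced_before \<theta> u w \<longleftrightarrow>
     (\<exists>i j. i < j \<and> j < length (new_vars \<theta>) \<and> new_vars \<theta> ! i = u \<and> new_vars \<theta> ! j = w)"

text \<open>First \<open>x\<close>, then the new variables that do not descend from \<open>y\<close>, then \<open>y\<close>, then the
  descendants of \<open>y\<close>; inside the two groups of new variables by time of introduction.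
  For \<open>x = y\<close>, when the requirements on \<open>y\<close> conflict with \<open>x\<close> being least, the order is
  \<open>x\<close> followed by the new variables by time of introduction. See \<open>var_less_unique\<close> below.\<close>

definition var_less :: "ovar \<Rightarrow> ovar \<Rightarrow> branch \<Rightarrow> ovar \<Rightarrow> ovar \<Rightarrow> bool" where
  "var_less x y \<theta> u w \<longleftrightarrow>
     u \<in> vars \<theta> \<and> w \<in> vars \<theta> \<and> u \<noteq> w \<and> w \<noteq> x \<and>
     (u = x
      \<or> (if x = y then introduced_before \<theta> u w
         else if w = y then \<not> descendant y \<theta> u y
         else if u = y then descendant y \<theta> w y
         else if descendant y \<theta> u y = descendant y \<theta> w y then introduced_before \<theta> u w
         else descendant y \<theta> w y))"

text \<open>The requirements on a total order of the variables of a branch which \<open>var_less\<close> realises.\<close>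

definition is_var_order :: "ovar \<Rightarrow> ovar \<Rightarrow> branch \<Rightarrow> (ovar \<Rightarrow> ovar \<Rightarrow> bool) \<Rightarrow> bool" where
  "is_var_order x y \<theta> lt \<longleftrightarrow>
     (\<forall>u \<in> vars \<theta>. \<not> lt u u) \<and>
     (\<forall>u \<in> vars \<theta>. \<forall>v \<in> vars \<theta>. \<forall>w \<in> vars \<theta>. lt u v \<longrightarrow> lt v w \<longrightarrow> lt u w) \<and>
     (\<forall>u \<in> vars \<theta>. \<forall>w \<in> vars \<theta>. u \<noteq> w \<longrightarrow> lt u w \<or> lt w u) \<and>
     (\<forall>w \<in> vars \<theta>. w \<noteq> x \<longrightarrow> lt x w) \<and>
     (\<forall>u \<in> vars \<theta> - {x, y}. \<forall>w \<in> vars \<theta> - {x, y}. introduced_before \<theta> u w \<longrightarrow> lt u w) \<and>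
     (\<forall>z \<in> vars \<theta>. descendant y \<theta> z y \<longrightarrow> lt y z) \<and>
     (\<forall>w \<in> vars \<theta>. w \<noteq> y \<longrightarrow> \<not> descendant y \<theta> w y \<longrightarrow> lt w y)"

lemma var_less_unique:
  assumes ord: "is_var_order x y \<theta> lt" and "x \<noteq> y"
    and xy: "x \<in> vars \<theta>" "y \<in> vars \<theta>"
    and new: "vars \<theta> - {x, y} \<subseteq> set (new_vars \<theta>)"
    and u: "u \<in> vars \<theta>" and w: "w \<in> vars \<theta>"
  shows "lt u w \<longleftrightarrow> var_less x y \<theta> u w"
proof -
  have irr: "\<not> lt a a" if "a \<in> vars \<theta>" for a
    using ord that by (auto simp: is_var_order_def)
  have tr: "lt a c" if "lt a b" "lt b c" "a \<in> vars \<theta>" "b \<in> vars \<theta>" "c \<in> vars \<theta>" for a b c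
    using ord that unfolding is_var_order_def by blast
  have tot: "introduced_before \<theta> a b \<or> introduced_before \<theta> b a"
    if ab: "a \<in> vars \<theta> - {x, y}" "b \<in> vars \<theta> - {x, y}" "a \<noteq> b" for a b
  proof -
    obtain i where i: "i < length (new_vars \<theta>)" "new_vars \<theta> ! i = a"
      using ab new in_set_conv_nth[of a "new_vars \<theta>"] by blast
    obtain j where j: "j < length (new_vars \<theta>)" "new_vars \<theta> ! j = b"
      using ab new in_set_conv_nth[of b "new_vars \<theta>"] by blast
    have "i < j \<or> j < i" using i j ab by (cases i j rule: linorder_cases) auto
    then show ?thesis using i j unfolding introduced_before_def by blast
  qed
  have imp: "lt a b" if ab: "var_less x y \<theta> a b" for a b
  proof -
    have a: "a \<in> vars \<theta>" and b: "b \<in> vars \<theta>" and bx: "b \<noteq> x" using ab by (auto simp: var_less_def)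
    have desc: "lt y c" if "c \<in> vars \<theta>" "descendant y \<theta> c y" for c
      using ord that by (auto simp: is_var_order_def)
    have nondesc: "lt c y" if "c \<in> vars \<theta>" "c \<noteq> y" "\<not> descendant y \<theta> c y" for c
      using ord that by (auto simp: is_var_order_def)
    have time: "lt c d" if "introduced_before \<theta> c d" "c \<in> vars \<theta> - {x, y}" "d \<in> vars \<theta> - {x, y}" for c d
      using ord that unfolding is_var_order_def by blast
    show ?thesis
    proof (cases "a = x \<or> a = y \<or> b = y")
      case True
      have "lt x b" using ord b bx by (auto simp: is_var_order_def)
      then show ?thesis
        using True ab desc nondesc a b \<open>x \<noteq> y\<close> unfolding var_less_def by (auto split: if_splits)
    next
      case False
      then have "(if descendant y \<theta> a y = descendant y \<theta> b y then introduced_before \<theta> a b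
                  else descendant y \<theta> b y)"
        using ab \<open>x \<noteq> y\<close>
        by (cases "descendant y \<theta> a y"; cases "descendant y \<theta> b y") (simp_all add: var_less_def)
      then show ?thesis
        using False bx a b time[of a b] tr[OF nondesc[of a] desc[of b]] xy
        by (auto split: if_splits)
    qed
  qed
  have total: "u = w \<or> var_less x y \<theta> u w \<or> var_less x y \<theta> w u"
    using u w tot[of u w] \<open>x \<noteq> y\<close> by (auto simp: var_less_def)
  show ?thesis
  proof
    assume lt: "lt u w"
    then have "u \<noteq> w" "\<not> lt w u" using irr tr u w by blast+
    then show "var_less x y \<theta> u w" using imp total by blast
  qed (rule imp)
qed


section \<open>Blocking\<close>

text \<open>Since \<open>w\<close> is new when \<open>z'(-(B;S))y\<close> is decomposed, all literals \<open>z'(-r)w\<close> of the branch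
  stem from \<open>z'(-B)w\<close>; \<open>copied_literals\<close> collects their counterparts with left variable \<open>z\<close>.\<close>

definition copied_literals :: "branch \<Rightarrow> ovar \<Rightarrow> ovar \<Rightarrow> ovar \<Rightarrow> fmla set" where
  "copied_literals \<theta> z' z w =
     {Fm z (Neg (RVar r)) w | r. Fm z' (Neg (RVar r)) w \<in> forms \<theta>}"

definition blocks :: "ovar \<Rightarrow> branch \<Rightarrow> ovar \<Rightarrow> ovar \<Rightarrow> rterm \<Rightarrow> rterm \<Rightarrow> bool" where
  "blocks y \<theta> z' z B S \<longleftrightarrow>
     z' \<noteq> z \<and>
     (\<exists>w. (NegComp w, Fm z' (Neg (Comp B S)) y) \<in> set (steps \<theta>) \<and>
          (\<forall>B1 Q. pos_bool B1 \<and> Fm z (Comp B1 Q) y \<in> forms \<theta> \<and>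
                  bool_constr (copied_literals \<theta> z' z w) (Fm z (Neg B1) w)
                  \<longrightarrow> Fm z' (Comp B1 Q) y \<in> forms \<theta>))"

definition blocked :: "ovar \<Rightarrow> branch \<Rightarrow> fmla \<Rightarrow> bool" where
  "blocked y \<theta> \<phi> \<longleftrightarrow>
     (\<exists>z z' B S. \<phi> = Fm z (Neg (Comp B S)) y \<and> pos_bool B \<and> blocks y \<theta> z' z B S)"


section \<open>The procedure\<close>

fun repeated :: "branch \<Rightarrow> app \<Rightarrow> bool" where
  "repeated \<theta> (NegComp z, \<phi>) = (\<exists>z'. (NegComp z', \<phi>) \<in> set (steps \<theta>))"
| "repeated \<theta> a = (a \<in> set (steps \<theta>))"

definition permitted :: "ovar \<Rightarrow> ovar \<Rightarrow> branch \<Rightarrow> app \<Rightarrow> fmla set list \<Rightarrow> bool" where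
  "permitted x y \<theta> a \<Gamma>s \<longleftrightarrow>
     applicable x y \<theta> a \<Gamma>s \<and> \<not> repeated \<theta> a \<and> \<not> blocked y \<theta> (snd a)"

text \<open>The variable on whose turn a rule application is carried out.\<close>

fun turn :: "app \<Rightarrow> ovar" where
  "turn (CompB z, \<phi>) = z"
| "turn (_, \<phi>) = lvar \<phi>"

fun rank :: "rule \<Rightarrow> nat" where
  "rank Boolean = 0"
| "rank (NegComp _) = 1"
| "rank (CompA _) = 2"
| "rank (CompB _) = 3"

definition outstanding :: "ovar \<Rightarrow> ovar \<Rightarrow> branch \<Rightarrow> ovar \<Rightarrow> bool" where
  "outstanding x y \<theta> z \<longleftrightarrow> (\<exists>a \<Gamma>s. permitted x y \<theta> a \<Gamma>s \<and> turn a = z)"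

definition expandable :: "ovar \<Rightarrow> ovar \<Rightarrow> branch \<Rightarrow> bool" where
  "expandable x y \<theta> \<longleftrightarrow> (\<exists>a \<Gamma>s. permitted x y \<theta> a \<Gamma>s)"

definition smallest_outstanding :: "ovar \<Rightarrow> ovar \<Rightarrow> branch \<Rightarrow> ovar \<Rightarrow> bool" where
  "smallest_outstanding x y \<theta> z \<longleftrightarrow>
     outstanding x y \<theta> z \<and> (\<forall>w. outstanding x y \<theta> w \<longrightarrow> \<not> var_less x y \<theta> w z)"

definition next_app :: "ovar \<Rightarrow> ovar \<Rightarrow> branch \<Rightarrow> ovar \<Rightarrow> app \<Rightarrow> fmla set list \<Rightarrow> bool" where
  "next_app x y \<theta> z a \<Gamma>s \<longleftrightarrow>
     permitted x y \<theta> a \<Gamma>s \<and> turn a = z \<and>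
     (\<forall>a' \<Gamma>s'. permitted x y \<theta> a' \<Gamma>s' \<and> turn a' = z \<longrightarrow> rank (fst a) \<le> rank (fst a'))"

text \<open>\<open>Select t\<close>: a branch of \<open>t\<close> is to be chosen. \<open>Consider t p\<close>: the branch at \<open>p\<close> is the
  current one, and it is to be decided how to go on. \<open>Saturate t p z\<close>: the current branch is
  being saturated for the variable \<open>z\<close>. \<open>Proved t\<close> and \<open>Open_branch t p\<close> are the two outcomes.\<close>

datatype state =
    Select dtree
  | Consider dtree "nat list"
  | Saturate dtree "nat list" ovar
  | Proved dtree
  | Open_branch dtree "nat list"

inductive proc_step :: "ovar \<Rightarrow> ovar \<Rightarrow> state \<Rightarrow> state \<Rightarrow> bool" for x y :: ovar where
  select:
    "branch_at t p = Some \<theta> \<Longrightarrow> \<not> axiomatic \<theta> \<Longrightarrow>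
     proc_step x y (Select t) (Consider t p)"
| nothing_to_select:
    "closed_tree t \<Longrightarrow>
     proc_step x y (Select t) (Proved t)"
| choose_variable:
    "branch_at t p = Some \<theta> \<Longrightarrow> \<not> axiomatic \<theta> \<Longrightarrow> smallest_outstanding x y \<theta> z \<Longrightarrow>
     proc_step x y (Consider t p) (Saturate t p z)"
| expand:
    "branch_at t p = Some \<theta> \<Longrightarrow> \<not> axiomatic \<theta> \<Longrightarrow> next_app x y \<theta> z a \<Gamma>s \<Longrightarrow> j < length \<Gamma>s \<Longrightarrow>
     proc_step x y (Saturate t p z) (Saturate (apply_at t p \<theta> a \<Gamma>s) (p @ [j]) z)"
| saturated:
    "branch_at t p = Some \<theta> \<Longrightarrow> axiomatic \<theta> \<or> \<not> outstanding x y \<theta> z \<Longrightarrow>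
     proc_step x y (Saturate t p z) (Consider t p)"
| all_closed:
    "branch_at t p = Some \<theta> \<Longrightarrow> axiomatic \<theta> \<Longrightarrow> closed_tree t \<Longrightarrow>
     proc_step x y (Consider t p) (Proved t)"
| next_branch:
    "branch_at t p = Some \<theta> \<Longrightarrow> axiomatic \<theta> \<Longrightarrow> \<not> closed_tree t \<Longrightarrow>
     proc_step x y (Consider t p) (Select t)"
| open_branch:
    "branch_at t p = Some \<theta> \<Longrightarrow> \<not> axiomatic \<theta> \<Longrightarrow> \<not> expandable x y \<theta> \<Longrightarrow>
     proc_step x y (Consider t p) (Open_branch t p)"

abbreviation run_from :: "fmla \<Rightarrow> state \<Rightarrow> state \<Rightarrow> bool" where
  "run_from \<phi> \<equiv> proc_step (lvar \<phi>) (rvar \<phi>)"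

text \<open>The choices left open by the procedure (branch, new variable, formula) are
  resolved arbitrarily: every run ends, and ends with a closed proof tree.\<close>

definition yields_proof_tree :: "fmla \<Rightarrow> bool" where
  "yields_proof_tree \<phi> \<longleftrightarrow>
     \<not> (\<exists>\<sigma>. \<sigma> 0 = Select (initial_tree \<phi>) \<and> (\<forall>i. run_from \<phi> (\<sigma> i) (\<sigma> (Suc i)))) \<and>
     (\<forall>s. (run_from \<phi>)\<^sup>*\<^sup>* (Select (initial_tree \<phi>)) s \<and> \<not> (\<exists>s'. run_from \<phi> s s') \<longrightarrow>
          (\<exists>t. s = Proved t \<and> proof_tree \<phi> t))"

end

theory Submission
  imports Defs
begin

text \<open>Termination: for a variable \<open>z\<close> let the profile of \<open>z\<close> be the set of terms \<open>R\<close> with \<open>zRy\<close>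
  on the branch. If \<open>z(-(B;S))y\<close> is not blocked, the profile of \<open>z\<close> is not contained in that of any
  \<open>z'\<close> for which \<open>-(B;S)\<close> was decomposed before. Profiles only grow and are subsets of a fixed
  finite set, so each \<open>-(B;S)\<close> introduces boundedly many variables. As no rule application is
  repeated, the length of branches is bounded.

  Completeness: on a saturated open branch let \<open>r\<close> relate \<open>u\<close> to \<open>w\<close> iff \<open>u(-r)w\<close> occurs, and let a
  blocked \<open>z\<close> copy the pairs of its blocker that lead to the variable introduced for the latter.
  The blocking condition is exactly what keeps the formulae \<open>z(B1;Q)y\<close> false after copying, so
  by induction on terms every formula of the branch is false.\<close>

section \<open>Reachable branches\<close>

definition extend :: "branch \<Rightarrow> app \<Rightarrow> fmla set \<Rightarrow> branch" where
  "extend \<theta> a \<Gamma> = Branch (nodes \<theta> @ [(leaf \<theta> - {snd a}) \<union> \<Gamma>]) (steps \<theta> @ [a])"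

text \<open>Branches are studied apart from trees, under \<open>permitted\<close> alone: neither the
  order of the variables nor that of the rules enters. Length bound and countermodel thus hold for
  every strategy that respects blocking and does not repeat applications.\<close>

inductive reachable :: "ovar \<Rightarrow> rterm \<Rightarrow> ovar \<Rightarrow> branch \<Rightarrow> bool" for x P y where
  init: "reachable x P y (Branch [{Fm x P y}] [])"
| step: "reachable x P y \<theta> \<Longrightarrow> permitted x y \<theta> a \<Gamma>s \<Longrightarrow> \<Gamma> \<in> set \<Gamma>s \<Longrightarrow>
         reachable x P y (extend \<theta> a \<Gamma>)"

lemma permittedD:
  assumes "permitted x y \<theta> a \<Gamma>s"
  shows "snd a \<in> leaf \<theta>" "decomposes x y (fst a) (snd a) \<Gamma>s" "side_condition \<theta> a"
    "\<not> repeated \<theta> a" "\<not> blocked y \<theta> (snd a)"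
  using assms by (auto simp: permitted_def applicable_def)

lemma set_new_vars: "z \<in> set (new_vars \<theta>) \<longleftrightarrow> (\<exists>\<phi>. (NegComp z, \<phi>) \<in> set (steps \<theta>))"
  by (force simp: new_vars_def split: rule.splits)

lemma reachable_nodes: "reachable x P y \<theta> \<Longrightarrow> nodes \<theta> \<noteq> []"
  by (induction rule: reachable.induct) (auto simp: extend_def)

lemma leaf_subset_forms: "reachable x P y \<theta> \<Longrightarrow> leaf \<theta> \<subseteq> forms \<theta>"
  using reachable_nodes[of x P y \<theta>] last_in_set by (auto simp: leaf_def forms_def)

lemma steps_extend [simp]: "steps (extend \<theta> a \<Gamma>) = steps \<theta> @ [a]"
  and leaf_extend [simp]: "leaf (extend \<theta> a \<Gamma>) = (leaf \<theta> - {snd a}) \<union> \<Gamma>"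
  by (simp_all add: extend_def leaf_def)

lemma forms_extend: "reachable x P y \<theta> \<Longrightarrow> forms (extend \<theta> a \<Gamma>) = forms \<theta> \<union> \<Gamma>"
  using leaf_subset_forms[of x P y \<theta>] by (auto simp: extend_def forms_def)

lemma vars_extend:
  "reachable x P y \<theta> \<Longrightarrow> vars (extend \<theta> a \<Gamma>) = vars \<theta> \<union> lvar ` \<Gamma> \<union> rvar ` \<Gamma>"
  by (auto simp: vars_def forms_extend)

lemma new_vars_extend:
  "new_vars (extend \<theta> a \<Gamma>) = new_vars \<theta> @ (case fst a of NegComp z \<Rightarrow> [z] | _ \<Rightarrow> [])"
  by (cases a) (auto simp: new_vars_def split: rule.splits)

lemma root_in_forms: "reachable x P y \<theta> \<Longrightarrow> Fm x P y \<in> forms \<theta>"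
  by (induction rule: reachable.induct) (auto simp: forms_extend, simp add: forms_def)

lemma root_vars: assumes "reachable x P y \<theta>" shows "x \<in> vars \<theta>" "y \<in> vars \<theta>"
  using root_in_forms[OF assms] by (force simp: vars_def)+

lemma vars_forms: "Fm u R w \<in> forms \<theta> \<Longrightarrow> u \<in> vars \<theta>" "Fm u R w \<in> forms \<theta> \<Longrightarrow> w \<in> vars \<theta>"
  by (force simp: vars_def)+

text \<open>Every Bool-construction rests on at least one literal of \<open>N\<close>, even for a
  \<open>Cap\<close>, where only one argument is constructed. Hence \<open>CompA\<close> never
  brings in a variable that does not occur yet.\<close>

lemma Bool_fm_vars: "\<phi> \<in> Bool_fm N \<Longrightarrow> \<exists>\<psi>\<in>N. lvar \<psi> = lvar \<phi> \<and> rvar \<psi> = rvar \<phi>"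
  by (induction rule: Bool_fm.induct) auto

lemma V_vars: "z \<in> V R u (forms \<theta>) \<Longrightarrow> z \<in> vars \<theta>"
  using Bool_fm_vars[of "Fm u (nf R) z" "forms \<theta>"] by (auto simp: V_def bool_constr_def vars_def)

lemma decomposes_finite: "decomposes x y r \<phi> \<Gamma>s \<Longrightarrow> \<Gamma> \<in> set \<Gamma>s \<Longrightarrow> finite \<Gamma>"
  by (erule decomposes.cases) auto

lemma decomposes_length: "decomposes x y r \<phi> \<Gamma>s \<Longrightarrow> 0 < length \<Gamma>s \<and> length \<Gamma>s \<le> 2"
  by (erule decomposes.cases) auto

lemma finite_forms: "reachable x P y \<theta> \<Longrightarrow> finite (forms \<theta>)"
proof (induction rule: reachable.induct)
  case init show ?case by (simp add: forms_def)
next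
  case step then show ?case
    using decomposes_finite permittedD(2) by (fastforce simp: forms_extend)
qed

lemma finite_vars: "reachable x P y \<theta> \<Longrightarrow> finite (vars \<theta>)"
  using finite_forms by (auto simp: vars_def)

text \<open>\<open>CompA\<close> and \<open>CompB\<close> work with occurring variables by their
  side conditions, and the Boolean rules keep the variables of the premise, so
  \<open>NegComp\<close> is the only source of variables.\<close>

lemma vars_step:
  assumes r: "reachable x P y \<theta>" and p: "permitted x y \<theta> a \<Gamma>s" and \<Gamma>: "\<Gamma> \<in> set \<Gamma>s"
  shows "vars (extend \<theta> a \<Gamma>) = vars \<theta> \<union> (case fst a of NegComp z \<Rightarrow> {z} | _ \<Rightarrow> {})"
proof -
  have l: "lvar (snd a) \<in> vars \<theta>" "rvar (snd a) \<in> vars \<theta>"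
    using leaf_subset_forms[OF r] permittedD(1)[OF p] by (auto simp: vars_def)
  have s: "side_condition \<theta> (fst a, snd a)" using permittedD(3)[OF p] by simp
  show ?thesis
    using permittedD(2)[OF p] s l \<Gamma> unfolding vars_extend[OF r]
    by (cases rule: decomposes.cases) (auto dest: V_vars)
qed

lemma NegComp_fresh:
  assumes "permitted x y \<theta> (NegComp z, \<phi>) \<Gamma>s"
  shows "z \<notin> vars \<theta>"
  using permittedD(2,3)[OF assms] by (auto elim!: decomposes.cases)

lemma reachable_new_vars:
  "reachable x P y \<theta> \<Longrightarrow>
   distinct (new_vars \<theta>) \<and> x \<notin> set (new_vars \<theta>) \<and> y \<notin> set (new_vars \<theta>) \<and>
   vars \<theta> = {x, y} \<union> set (new_vars \<theta>)"
proof (induction rule: reachable.induct)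
  case init
  show ?case by (simp add: new_vars_def vars_def forms_def insert_commute)
next
  case (step \<theta> a \<Gamma>s \<Gamma>)
  obtain r \<phi> where a: "a = (r, \<phi>)" by fastforce
  note v = vars_step[OF step.hyps, unfolded a]
  show ?case
  proof (cases "\<exists>z. r = NegComp z")
    case True
    then obtain z where r: "r = NegComp z" by blast
    have "z \<notin> vars \<theta>" using NegComp_fresh step.hyps(2) a r by metis
    then show ?thesis
      using step.IH v by (simp add: new_vars_extend a r)
  next
    case False
    then show ?thesis
      using step.IH v by (cases r) (simp_all add: new_vars_extend a)
  qed
qed

text \<open>A formula leaves the current node only by being decomposed, and \<open>CompA\<close> and
  \<open>CompB\<close> put their premise back.\<close>

lemma forms_in_leaf:
  "reachable x P y \<theta> \<Longrightarrow> \<phi> \<in> forms \<theta> \<Longrightarrow>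
   \<phi> \<in> leaf \<theta> \<or> (Boolean, \<phi>) \<in> set (steps \<theta>) \<or> (\<exists>z. (NegComp z, \<phi>) \<in> set (steps \<theta>))"
proof (induction rule: reachable.induct)
  case init then show ?case by (simp add: forms_def leaf_def)
next
  case (step \<theta> a \<Gamma>s \<Gamma>)
  show ?case
  proof (cases "\<phi> \<in> \<Gamma>")
    case False
    show ?thesis
    proof (cases "\<phi> = snd a")
      case True
      have "fst a = Boolean \<or> (\<exists>z. fst a = NegComp z) \<or> snd a \<in> \<Gamma>"
        using permittedD(2)[OF step.hyps(2)] step.hyps(3) by (cases rule: decomposes.cases) auto
      then show ?thesis using True False by (metis UnCI list.set_intros(1) prod.collapse set_append steps_extend)
    next
      case neq: False
      then show ?thesis using step False by (auto simp: forms_extend)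
    qed
  qed simp
qed

text \<open>A branch records rule and premise only; this recovers the alternative that it
  followed.\<close>

lemma steps_decomposed:
  "reachable x P y \<theta> \<Longrightarrow> (r, \<phi>) \<in> set (steps \<theta>) \<Longrightarrow>
   \<exists>\<Gamma>s \<Gamma>. decomposes x y r \<phi> \<Gamma>s \<and> \<Gamma> \<in> set \<Gamma>s \<and> \<Gamma> \<subseteq> forms \<theta> \<and> \<phi> \<in> forms \<theta>"
proof (induction rule: reachable.induct)
  case (step \<theta> a \<Gamma>s \<Gamma>)
  show ?case
  proof (cases "(r, \<phi>) = a")
    case True
    then have "\<phi> \<in> forms \<theta>" "decomposes x y r \<phi> \<Gamma>s"
      using permittedD(1,2)[OF step.hyps(2)] leaf_subset_forms[OF step.hyps(1)] by auto
    then show ?thesis using step.hyps by (intro exI[of _ \<Gamma>s] exI[of _ \<Gamma>]) (simp add: forms_extend)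
  next
    case False
    then show ?thesis using step by (auto simp: forms_extend)
  qed
qed simp

lemma NegComp_unique:
  "reachable x P y \<theta> \<Longrightarrow> (NegComp z, \<phi>) \<in> set (steps \<theta>) \<Longrightarrow> (NegComp z, \<psi>) \<in> set (steps \<theta>) \<Longrightarrow>
   \<phi> = \<psi>"
proof (induction rule: reachable.induct)
  case (step \<theta> a \<Gamma>s \<Gamma>)
  have "\<not> (a = (NegComp z, \<chi>) \<and> (NegComp z, \<chi>') \<in> set (steps \<theta>))" for \<chi> \<chi>'
    using reachable_new_vars[OF step.hyps(1)] NegComp_fresh[of x y \<theta> z \<chi>] step.hyps(2)
    by (auto simp: set_new_vars)
  then show ?case using step by auto
qed simp


section \<open>The shape of the formulae on a branch\<close>

text \<open>The flag tells whether \<open>Comp One S\<close> is admitted outside of compositions; this happens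
  only for the left variable of the root.\<close>

fun in_frag :: "bool \<Rightarrow> rterm \<Rightarrow> bool" where
  "in_frag b (RVar r) = True"
| "in_frag b One = True"
| "in_frag b (Neg R) = in_frag b R"
| "in_frag b (Cup R S) = (in_frag b R \<and> in_frag b S)"
| "in_frag b (Cap R S) = (in_frag b R \<and> in_frag b S)"
| "in_frag b (Comp R S) = ((pos_bool R \<or> b \<and> R = One) \<and> in_frag False S)"

lemma in_frag_mono: "in_frag False R \<Longrightarrow> in_frag b R"
  by (induction R) auto

text \<open>The right argument of a composition is \<open>One\<close> or \<open>one_guarded\<close>,
  and \<open>one_guarded\<close> excludes \<open>Comp One S\<close>; so the flag may drop to
  \<open>False\<close> below a composition.\<close>

lemma RT0_in_frag: "P \<in> RT0 \<Longrightarrow> in_frag True P \<and> (one_guarded P \<longrightarrow> in_frag False P)"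
  by (induction rule: RT0.induct) auto

text \<open>The second alternative covers what \<open>NegComp\<close> produces from the left
  argument of a composition. Decomposing \<open>Neg B\<close> with \<open>B\<close> positive yields
  only terms of the same kind, and their right variable still points to the step that introduced
  it.\<close>

definition well_shaped :: "ovar \<Rightarrow> ovar \<Rightarrow> branch \<Rightarrow> fmla \<Rightarrow> bool" where
  "well_shaped x y \<theta> \<phi> \<longleftrightarrow>
     rvar \<phi> = y \<and> in_frag (lvar \<phi> = x) (rel \<phi>) \<or>
     (\<exists>B \<psi>. rel \<phi> = Neg B \<and> pos_bool B \<and> (NegComp (rvar \<phi>), \<psi>) \<in> set (steps \<theta>) \<and> lvar \<psi> = lvar \<phi>)"

lemma well_shaped_decomposes:
  assumes d: "decomposes x y r \<phi> \<Gamma>s" and \<Gamma>: "\<Gamma> \<in> set \<Gamma>s" and w: "well_shaped x y \<theta> \<phi>" and \<chi>: "\<chi> \<in> \<Gamma>"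
  shows "well_shaped x y (extend \<theta> (r, \<phi>) \<Gamma>) \<chi>"
proof -
  \<comment> \<open>Arguments of compositions satisfy the strong form of \<open>in_frag\<close>, so
    it does not matter whether their new left variable is \<open>x\<close>.\<close>
  have right: "well_shaped x y (extend \<theta> (r, \<phi>) \<Gamma>) \<chi>"
    if "rvar \<chi> = y" "in_frag False (rel \<chi>)"
    using that in_frag_mono[of "rel \<chi>" "lvar \<chi> = x"] by (simp add: well_shaped_def)
  have left: "well_shaped x y (extend \<theta> (r, \<phi>) \<Gamma>) (Fm u (Neg B) z)"
    if "pos_bool B" "r = NegComp z" "lvar \<phi> = u" for u B z
    using that by (auto simp: well_shaped_def)
  show ?thesis
    using d
  proof (cases rule: decomposes.cases)
    case (6 B S z u)
    have "in_frag False S" using w 6 by (simp add: well_shaped_def)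
    then show ?thesis using 6 \<Gamma> \<chi> left right by auto
  next
    case (7 B z u)
    then show ?thesis using \<Gamma> \<chi> left by auto
  next
    case (8 S z)
    then show ?thesis using \<Gamma> w \<chi> right by (simp add: well_shaped_def)
  next
    case (9 B z u S)
    then have "in_frag False S" using w by (simp add: well_shaped_def)
    then show ?thesis using 9 \<Gamma> \<chi> right w
      by (cases "\<chi> = Fm z S y") (simp_all add: well_shaped_def)
  next
    case (10 z S)
    then have "in_frag False S" using w by (simp add: well_shaped_def)
    then show ?thesis using 10 \<Gamma> \<chi> right w
      by (cases "\<chi> = Fm z S y") (simp_all add: well_shaped_def)
  qed (use \<Gamma> w \<chi> in \<open>auto simp: well_shaped_def\<close>)
qed

lemma reachable_well_shaped:
  assumes "P \<in> RT0"
  shows "reachable x P y \<theta> \<Longrightarrow> \<phi> \<in> forms \<theta> \<Longrightarrow> well_shaped x y \<theta> \<phi>"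
proof (induction arbitrary: \<phi> rule: reachable.induct)
  case init then show ?case using RT0_in_frag[OF assms] by (simp add: forms_def well_shaped_def)
next
  case (step \<theta> a \<Gamma>s \<Gamma>)
  have "snd a \<in> forms \<theta>"
    using permittedD(1)[OF step.hyps(2)] leaf_subset_forms[OF step.hyps(1)] by blast
  then have "\<phi> \<in> \<Gamma> \<Longrightarrow> ?case"
    using well_shaped_decomposes[OF permittedD(2)[OF step.hyps(2)] step.hyps(3) step.IH] by simp
  moreover have "\<phi> \<in> forms \<theta> \<Longrightarrow> ?case"
    using step.IH[of \<phi>] by (auto simp: well_shaped_def)
  ultimately show ?case using step.prems step.hyps(1) by (auto simp: forms_extend)
qed

section \<open>The finite set of terms that can occur on a branch\<close>

fun subterms :: "rterm \<Rightarrow> rterm set" where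
  "subterms (RVar r) = {RVar r}"
| "subterms One = {One}"
| "subterms (Neg R) = insert (Neg R) (subterms R)"
| "subterms (Cup R S) = insert (Cup R S) (subterms R \<union> subterms S)"
| "subterms (Cap R S) = insert (Cap R S) (subterms R \<union> subterms S)"
| "subterms (Comp R S) = insert (Comp R S) (subterms R \<union> subterms S)"

lemma subterms_refl: "R \<in> subterms R"
  by (cases R) auto

lemma subterms_trans: "R \<in> subterms S \<Longrightarrow> S \<in> subterms T \<Longrightarrow> R \<in> subterms T"
  by (induction T) auto

lemma subterms_args:
  "Neg R \<in> subterms T \<Longrightarrow> R \<in> subterms T"
  "Cup R S \<in> subterms T \<Longrightarrow> R \<in> subterms T" "Cup R S \<in> subterms T \<Longrightarrow> S \<in> subterms T"
  "Cap R S \<in> subterms T \<Longrightarrow> R \<in> subterms T" "Cap R S \<in> subterms T \<Longrightarrow> S \<in> subterms T"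
  "Comp R S \<in> subterms T \<Longrightarrow> R \<in> subterms T" "Comp R S \<in> subterms T \<Longrightarrow> S \<in> subterms T"
  by (erule subterms_trans[rotated]; simp add: subterms_refl)+

text \<open>The rules push a complement inwards by one level, so one complement on top of a subterm
  of the root term is all that can arise.\<close>

definition closure :: "rterm \<Rightarrow> rterm set" where
  "closure P = subterms P \<union> Neg ` subterms P"

lemma finite_closure: "finite (closure P)"
proof -
  have "finite (subterms P)" by (induction P) auto
  then show ?thesis by (simp add: closure_def)
qed

lemma closure_intros:
  "R \<in> subterms P \<Longrightarrow> R \<in> closure P" "R \<in> subterms P \<Longrightarrow> Neg R \<in> closure P"
  by (simp_all add: closure_def)

lemma closure_dests:
  "Neg R \<in> closure P \<Longrightarrow> R \<in> subterms P" "Cup R S \<in> closure P \<Longrightarrow> Cup R S \<in> subterms P"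
  "Cap R S \<in> closure P \<Longrightarrow> Cap R S \<in> subterms P" "Comp R S \<in> closure P \<Longrightarrow> Comp R S \<in> subterms P"
  using subterms_args(1)[of R P] by (auto simp: closure_def)

lemma closure_decomposes:
  assumes d: "decomposes x y r \<phi> \<Gamma>s" and "\<Gamma> \<in> set \<Gamma>s" "rel \<phi> \<in> closure P" "\<chi> \<in> \<Gamma>"
  shows "rel \<chi> \<in> closure P"
  using d
proof (cases rule: decomposes.cases)
qed (use assms in \<open>clarsimp, (elim disjE)?;
  force dest: closure_dests subterms_args intro: closure_intros\<close>)+

lemma reachable_closure: "reachable x P y \<theta> \<Longrightarrow> \<phi> \<in> forms \<theta> \<Longrightarrow> rel \<phi> \<in> closure P"
proof (induction arbitrary: \<phi> rule: reachable.induct)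
  case init then show ?case by (simp add: forms_def closure_def subterms_refl)
next
  case (step \<theta> a \<Gamma>s \<Gamma>)
  have "snd a \<in> forms \<theta>"
    using permittedD(1)[OF step.hyps(2)] leaf_subset_forms[OF step.hyps(1)] by blast
  then show ?case
    using closure_decomposes[OF permittedD(2)[OF step.hyps(2)] step.hyps(3) step.IH] step
    by (auto simp: forms_extend)
qed


section \<open>Bounding the length of branches\<close>

definition profile :: "ovar \<Rightarrow> branch \<Rightarrow> ovar \<Rightarrow> rterm set" where
  "profile y \<theta> z = {R. Fm z R y \<in> forms \<theta>}"

lemma profile_extend: "reachable x P y \<theta> \<Longrightarrow> profile y' \<theta> z \<subseteq> profile y' (extend \<theta> a \<Gamma>) z"
  by (auto simp: profile_def forms_extend)

text \<open>Inclusion instead of equality of profiles: the profile of \<open>z\<close> may grow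
  after the decomposition, and inclusion survives this. Inclusion is also what yields
  blocking.\<close>

definition charged :: "ovar \<Rightarrow> branch \<Rightarrow> rterm \<times> rterm set \<Rightarrow> bool" where
  "charged y \<theta> RC \<longleftrightarrow>
     (\<exists>z w. (NegComp w, Fm z (fst RC) y) \<in> set (steps \<theta>) \<and> snd RC \<subseteq> profile y \<theta> z)"

lemma charged_extend: "reachable x P y \<theta> \<Longrightarrow> charged y \<theta> RC \<Longrightarrow> charged y (extend \<theta> a \<Gamma>) RC"
  unfolding charged_def
  by (elim exE, intro exI) (use profile_extend[of x P y \<theta> y _ a \<Gamma>] in \<open>auto dest: subsetD\<close>)

lemma decomposes_NegComp:
  assumes "decomposes x y (NegComp w) \<phi> \<Gamma>s"
  shows "rvar \<phi> = y"
    "(\<exists>B S. pos_bool B \<and> rel \<phi> = Neg (Comp B S)) \<or> lvar \<phi> = x"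
  using assms by (cases rule: decomposes.cases; simp)+

text \<open>Were the pair charged through \<open>z\<close>, all formulae \<open>u(B1;Q)y\<close>
  would have their counterpart at \<open>z\<close>, so the blocking condition would hold whatever
  the literals are, and \<open>u\<close> would be blocked by \<open>z\<close>.\<close>

lemma not_charged:
  assumes r: "reachable x P y \<theta>" and p: "permitted x y \<theta> (NegComp w, Fm u R y) \<Gamma>s"
  shows "\<not> charged y \<theta> (R, profile y \<theta> u)"
proof
  assume "charged y \<theta> (R, profile y \<theta> u)"
  then obtain z w' where zw: "(NegComp w', Fm z R y) \<in> set (steps \<theta>)"
    and le: "profile y \<theta> u \<subseteq> profile y \<theta> z" by (auto simp: charged_def)
  have "z \<noteq> u" using permittedD(4)[OF p] zw by auto
  have dz: "\<exists>\<Gamma>s. decomposes x y (NegComp w') (Fm z R y) \<Gamma>s"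
    using steps_decomposed[OF r zw] by blast
  have du: "decomposes x y (NegComp w) (Fm u R y) \<Gamma>s" using permittedD(2)[OF p] by simp
  \<comment> \<open>A term \<open>Neg (Comp One S)\<close> is decomposed at the left variable
    \<open>x\<close> only, and \<open>z\<close>, \<open>u\<close> are not both
    \<open>x\<close>.\<close>
  obtain B S where B: "pos_bool B" "R = Neg (Comp B S)"
    using dz du \<open>z \<noteq> u\<close> by (metis decomposes_NegComp(2) fmla.sel)
  have "blocks y \<theta> z u B S"
    using zw le B \<open>z \<noteq> u\<close> unfolding blocks_def profile_def by blast
  then show False using permittedD(5)[OF p] B by (auto simp: blocked_def)
qed

text \<open>Each introduction of a variable is charged to the decomposed term together with the profile
  of its left variable at that time. Blocking excludes that a pair is charged twice.\<close>

lemma new_vars_charge: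
  "reachable x P y \<theta> \<Longrightarrow>
   \<exists>D \<subseteq> closure P \<times> Pow (closure P). card D = length (new_vars \<theta>) \<and> (\<forall>RC \<in> D. charged y \<theta> RC)"
proof (induction rule: reachable.induct)
  case init
  show ?case by (rule exI[of _ "{}"]) (simp add: new_vars_def)
next
  case (step \<theta> a \<Gamma>s \<Gamma>)
  then obtain D where D: "D \<subseteq> closure P \<times> Pow (closure P)" "card D = length (new_vars \<theta>)"
    and Dst: "\<And>RC. RC \<in> D \<Longrightarrow> charged y \<theta> RC" by blast
  have Dst': "\<forall>RC\<in>D. charged y (extend \<theta> a \<Gamma>) RC"
    using Dst charged_extend[OF step.hyps(1)] by blast
  obtain r \<phi> where a: "a = (r, \<phi>)" by fastforce
  show ?case
  proof (cases "\<exists>w. r = NegComp w")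
    case False
    then have "new_vars (extend \<theta> a \<Gamma>) = new_vars \<theta>"
      unfolding new_vars_extend a by (cases r) simp_all
    then show ?thesis using D Dst' by auto
  next
    case True
    then obtain w where w: "r = NegComp w" by blast
    obtain u R where \<phi>: "\<phi> = Fm u R y"
      using decomposes_NegComp(1) permittedD(2)[OF step.hyps(2)] unfolding a w
      by (metis fmla.exhaust_sel fst_conv snd_conv)
    let ?RC = "(R, profile y \<theta> u)"
    have nin: "?RC \<notin> D"
      using Dst not_charged[of x P y \<theta> w u R \<Gamma>s] step.hyps unfolding a w \<phi> by blast
    have "Fm u R y \<in> forms \<theta>"
      using permittedD(1)[OF step.hyps(2)] leaf_subset_forms[OF step.hyps(1)] a \<phi> by auto
    then have "?RC \<in> closure P \<times> Pow (closure P)"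
      using reachable_closure[OF step.hyps(1)] by (force simp: profile_def)
    then have "insert ?RC D \<subseteq> closure P \<times> Pow (closure P)" using D by blast
    moreover have "finite D"
      using D(1) by (rule finite_subset) (simp add: finite_closure)
    then have "card (insert ?RC D) = length (new_vars (extend \<theta> a \<Gamma>))"
      using D(2) nin by (simp add: new_vars_extend a w)
    moreover have "charged y (extend \<theta> a \<Gamma>) ?RC"
      unfolding charged_def using profile_extend[OF step.hyps(1)]
      by (intro exI[of _ u] exI[of _ w]) (simp add: a w \<phi>)
    ultimately show ?thesis using Dst' by (intro exI[of _ "insert ?RC D"]) simp
  qed
qed

text \<open>The 2 accounts for \<open>x\<close> and \<open>y\<close>, the other summand for the
  pairs that can be charged.\<close>

definition var_bound :: "rterm \<Rightarrow> nat" where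
  "var_bound P = 2 + card (closure P \<times> Pow (closure P))"

lemma card_vars:
  assumes "reachable x P y \<theta>"
  shows "card (vars \<theta>) \<le> var_bound P"
proof -
  obtain D where "D \<subseteq> closure P \<times> Pow (closure P)" "card D = length (new_vars \<theta>)"
    using new_vars_charge[OF assms] by blast
  then have "length (new_vars \<theta>) \<le> card (closure P \<times> Pow (closure P))"
    by (metis card_mono finite_Pow_iff finite_SigmaI finite_closure)
  moreover have "card (vars \<theta>) \<le> card {x, y} + card (set (new_vars \<theta>))"
    using reachable_new_vars[OF assms] card_Un_le by metis
  moreover have "card {x, y} \<le> 2" by (simp add: card_insert_if)
  ultimately show ?thesis using card_length[of "new_vars \<theta>"] by (simp add: var_bound_def)
qed

section \<open>Counting rule applications\<close>

lemma distinct_steps: "reachable x P y \<theta> \<Longrightarrow> distinct (steps \<theta>)"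
proof (induction rule: reachable.induct)
  case (step \<theta> a \<Gamma>s \<Gamma>)
  obtain r \<phi> where "a = (r, \<phi>)" by fastforce
  then have "a \<notin> set (steps \<theta>)" using permittedD(4)[OF step.hyps(2)] by (cases r) auto
  then show ?case using step by simp
qed simp

lemma steps_range:
  assumes r: "reachable x P y \<theta>"
  shows "set (steps \<theta>) \<subseteq>
    ({Boolean} \<union> NegComp ` vars \<theta> \<union> CompA ` vars \<theta> \<union> CompB ` vars \<theta>) \<times>
    (\<lambda>(u, R, w). Fm u R w) ` (vars \<theta> \<times> closure P \<times> vars \<theta>)" (is "_ \<subseteq> ?A \<times> ?B")
proof (intro subrelI)
  fix q \<phi> assume a: "(q, \<phi>) \<in> set (steps \<theta>)"
  obtain \<Gamma>s \<Gamma> where d: "decomposes x y q \<phi> \<Gamma>s" "\<Gamma> \<in> set \<Gamma>s" "\<Gamma> \<subseteq> forms \<theta>" "\<phi> \<in> forms \<theta>"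
    using steps_decomposed[OF r a] by blast
  have "q \<in> ?A" using d by (cases rule: decomposes.cases) (auto dest: vars_forms)
  moreover have "\<phi> \<in> ?B"
    using d(4) reachable_closure[OF r d(4)] by (cases \<phi>) (force dest: vars_forms)
  ultimately show "(q, \<phi>) \<in> ?A \<times> ?B" by blast
qed

text \<open>The first factor counts the rules together with their variable, the second the possible
  premises: two variables and a term of the closure.\<close>

definition step_bound :: "rterm \<Rightarrow> nat" where
  "step_bound P = (1 + 3 * var_bound P) * (var_bound P * (card (closure P) * var_bound P))"

lemma length_steps:
  assumes r: "reachable x P y \<theta>"
  shows "length (steps \<theta>) \<le> step_bound P"
proof -
  let ?X = "vars \<theta>"
  let ?A = "{Boolean} \<union> NegComp ` ?X \<union> CompA ` ?X \<union> CompB ` ?X"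
  let ?B = "(\<lambda>(u, R, w). Fm u R w) ` (?X \<times> closure P \<times> ?X)"
  have fin: "finite ?X" "finite ?A" "finite ?B" using finite_vars[OF r] finite_closure by auto
  have cX: "card ?X \<le> var_bound P" by (rule card_vars[OF r])
  have "card ?A \<le> card {Boolean} + card (NegComp ` ?X) + card (CompA ` ?X) + card (CompB ` ?X)"
    by (metis (no_types, lifting) add_right_mono card_Un_le le_trans)
  also have "\<dots> \<le> 1 + 3 * var_bound P"
    using cX card_image_le[OF fin(1), of NegComp] card_image_le[OF fin(1), of CompA]
      card_image_le[OF fin(1), of CompB] by simp
  finally have A: "card ?A \<le> 1 + 3 * var_bound P" .
  have "card ?B \<le> card (?X \<times> closure P \<times> ?X)"
    using fin finite_closure by (intro card_image_le) auto
  also have "\<dots> \<le> var_bound P * (card (closure P) * var_bound P)"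
    using cX by (simp add: card_cartesian_product mult_le_mono)
  finally have B: "card ?B \<le> var_bound P * (card (closure P) * var_bound P)" .
  have "length (steps \<theta>) = card (set (steps \<theta>))"
    using distinct_steps[OF r] by (simp add: distinct_card)
  also have "\<dots> \<le> card (?A \<times> ?B)"
    using steps_range[OF r] fin by (intro card_mono) auto
  also have "\<dots> = card ?A * card ?B"
    by (rule card_cartesian_product)
  also have "\<dots> \<le> step_bound P"
    unfolding step_bound_def by (rule mult_le_mono[OF A B])
  finally show ?thesis .
qed


section \<open>The order on variables\<close>

definition position :: "'a list \<Rightarrow> 'a \<Rightarrow> nat" where
  "position xs a = length (takeWhile (\<lambda>b. b \<noteq> a) xs)"

lemma position_le: "position xs a \<le> length xs"
  by (simp add: position_def length_takeWhile_le)

lemma position_nth: "distinct xs \<Longrightarrow> i < length xs \<Longrightarrow> position xs (xs ! i) = i"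
proof (induction xs arbitrary: i)
  case (Cons a xs)
  then show ?case by (cases i) (auto simp: position_def)
qed simp

text \<open>Maps \<open>var_less\<close> strictly monotonically into the natural numbers, so that
  minimal variables exist. Positions are at most \<open>n\<close>: variables before \<open>y\<close>
  have rank at most \<open>n + 1\<close>, \<open>y\<close> has \<open>n + 2\<close>, its descendants
  at least \<open>n + 3\<close>.\<close>

definition var_rank :: "ovar \<Rightarrow> ovar \<Rightarrow> branch \<Rightarrow> ovar \<Rightarrow> nat" where
  "var_rank x y \<theta> u =
     (let n = length (new_vars \<theta>); i = position (new_vars \<theta>) u in
      if u = x then 0
      else if x = y then i + 1
      else if u = y then n + 2
      else if descendant y \<theta> u y then n + i + 3 else i + 1)"

lemma var_less_rank:
  assumes d: "distinct (new_vars \<theta>)" and l: "var_less x y \<theta> u w"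
  shows "var_rank x y \<theta> u < var_rank x y \<theta> w"
proof -
  have "position (new_vars \<theta>) a < position (new_vars \<theta>) b" if "introduced_before \<theta> a b" for a b
    using that d by (auto simp: introduced_before_def position_nth)
  moreover have "position (new_vars \<theta>) a \<le> length (new_vars \<theta>)" for a
    by (rule position_le)
  ultimately show ?thesis
    using l unfolding var_less_def var_rank_def Let_def
    by (auto split: if_splits simp: Suc_le_eq less_Suc_eq_le trans_le_add1 le_SucI)
qed

lemma smallest_outstanding_exists:
  assumes r: "reachable x P y \<theta>" and "expandable x y \<theta>"
  shows "\<exists>z. smallest_outstanding x y \<theta> z"
proof -
  obtain z0 where "outstanding x y \<theta> z0"
    using assms(2) by (auto simp: expandable_def outstanding_def)
  then obtain z where "outstanding x y \<theta> z"
    "\<And>w. outstanding x y \<theta> w \<Longrightarrow> var_rank x y \<theta> z \<le> var_rank x y \<theta> w"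
    using ex_has_least_nat[of "outstanding x y \<theta>" z0 "var_rank x y \<theta>"] by blast
  then show ?thesis
    using var_less_rank reachable_new_vars[OF r] unfolding smallest_outstanding_def
    by (meson leD)
qed

lemma next_app_exists:
  assumes "outstanding x y \<theta> z"
  shows "\<exists>a \<Gamma>s. next_app x y \<theta> z a \<Gamma>s"
proof -
  let ?Q = "\<lambda>q. permitted x y \<theta> (fst q) (snd q) \<and> turn (fst q) = z"
  obtain q0 where "?Q q0" using assms by (auto simp: outstanding_def)
  then obtain q where "?Q q" "\<And>q'. ?Q q' \<Longrightarrow> rank (fst (fst q)) \<le> rank (fst (fst q'))"
    using ex_has_least_nat[of ?Q q0 "\<lambda>q. rank (fst (fst q))"] by blast
  then show ?thesis unfolding next_app_def by (metis fst_conv snd_conv)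
qed


section \<open>The countermodel of an open branch\<close>

text \<open>Without complement, a Boolean term is monotone in the atoms that hold at a pair. Two
  different pairs are compared because blocking transports atoms from one pair to another.\<close>

lemma pos_bool_interp_mono:
  assumes "pos_bool B" "\<And>r. (a, b) \<in> m r \<Longrightarrow> (c, d) \<in> m r" "(a, b) \<in> interp U m B"
  shows "(c, d) \<in> interp U m B"
  using assms(1,3) by (induction B rule: pos_bool.induct) (auto dest: assms(2))

lemma is_cnf_nf_Neg: "pos_bool B \<Longrightarrow> is_cnf (nf (Neg B))"
  by (induction B rule: pos_bool.induct) auto

text \<open>\<open>nf\<close> turns the unions of \<open>B\<close> into \<open>Cap\<close>, which
  can be constructed from one argument, and the intersections into \<open>Cup\<close>, which needs
  both; this mirrors the truth conditions of \<open>B\<close>. Thus pairs in the interpretation of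
  \<open>B\<close> lead to applications of \<open>CompA\<close>.\<close>

lemma bool_constr_Neg:
  assumes "pos_bool B" "\<And>r. (a, b) \<in> m r \<Longrightarrow> Fm u (Neg (RVar r)) w \<in> N" "(a, b) \<in> interp U m B"
  shows "bool_constr N (Fm u (Neg B) w)"
proof -
  have "Fm u (nf (Neg B)) w \<in> Bool_fm N"
    using assms(1,3)
    by (induction B rule: pos_bool.induct)
      (auto intro: Bool_fm.intros is_cnf_nf_Neg assms(2))
  then show ?thesis by (simp add: bool_constr_def)
qed

text \<open>\<open>blocks\<close> with its witness \<open>w\<close> exposed, since the countermodel
  has to know where the copied pairs end.\<close>

definition blocks_via :: "ovar \<Rightarrow> branch \<Rightarrow> ovar \<Rightarrow> ovar \<Rightarrow> rterm \<Rightarrow> rterm \<Rightarrow> ovar \<Rightarrow> bool" where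
  "blocks_via y \<theta> z' z B S w \<longleftrightarrow>
     z' \<noteq> z \<and> (NegComp w, Fm z' (Neg (Comp B S)) y) \<in> set (steps \<theta>) \<and>
     (\<forall>B1 Q. pos_bool B1 \<and> Fm z (Comp B1 Q) y \<in> forms \<theta> \<and>
        bool_constr (copied_literals \<theta> z' z w) (Fm z (Neg B1) w) \<longrightarrow> Fm z' (Comp B1 Q) y \<in> forms \<theta>)"

lemma blocks_iff: "blocks y \<theta> z' z B S \<longleftrightarrow> (\<exists>w. blocks_via y \<theta> z' z B S w)"
  by (auto simp: blocks_def blocks_via_def)

text \<open>A blocked variable \<open>z\<close> inherits from its blocker \<open>z'\<close> the pairs that lead to \<open>w\<close>.\<close>

definition branch_rel :: "ovar \<Rightarrow> branch \<Rightarrow> rvar \<Rightarrow> (ovar \<times> ovar) set" where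
  "branch_rel y \<theta> r =
     {(u, w). Fm u (Neg (RVar r)) w \<in> forms \<theta>} \<union>
     {(z, w). \<exists>z' B S. Fm z (Neg (Comp B S)) y \<in> forms \<theta> \<and> blocks_via y \<theta> z' z B S w \<and>
                Fm z' (Neg (RVar r)) w \<in> forms \<theta>}"

lemma decomposes_Boolean_NegComp:
  "decomposes x y Boolean \<phi> \<Gamma>s \<Longrightarrow> \<not> decomposes x y (NegComp z) \<phi> \<Delta>s"
  "decomposes x y Boolean \<phi> \<Gamma>s \<Longrightarrow> \<phi> \<noteq> Fm u (Neg (Comp B S)) w"
  by (erule decomposes.cases; auto elim: decomposes.cases)+

section \<open>Saturation and falsification on an open branch\<close>

locale open_branch =
  fixes x y :: ovar and P :: rterm and \<theta> :: branch
  assumes P: "P \<in> RT0" and reach: "reachable x P y \<theta>"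
    and nax: "\<not> axiomatic \<theta>" and nexp: "\<not> expandable x y \<theta>"
begin

abbreviation "M \<equiv> interp (vars \<theta>) (branch_rel y \<theta>)"

lemma leaf_nax: "\<not> axiomatic_set (leaf \<theta>)"
  using nax reachable_nodes[OF reach] by (auto simp: axiomatic_def leaf_def)

lemma not_permitted: "\<not> permitted x y \<theta> a \<Gamma>s"
  using nexp unfolding expandable_def by blast

lemma decomposed_Boolean:
  assumes "(Boolean, \<phi>) \<in> set (steps \<theta>)"
  shows "\<exists>\<Gamma>s \<Gamma>. decomposes x y Boolean \<phi> \<Gamma>s \<and> \<Gamma> \<in> set \<Gamma>s \<and> \<Gamma> \<subseteq> forms \<theta>"
  using steps_decomposed[OF reach assms] by blast

text \<open>Axioms are looked for in single nodes, whereas \<open>forms\<close> collects all nodes.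
  Formulae that no rule removes persist to the leaf, so complementary literals from different nodes
  would meet there.\<close>

lemma undecomposable_in_leaf:
  assumes "\<phi> \<in> forms \<theta>" "\<And>\<Gamma>s. \<not> decomposes x y Boolean \<phi> \<Gamma>s" "\<And>z \<Gamma>s. \<not> decomposes x y (NegComp z) \<phi> \<Gamma>s"
  shows "\<phi> \<in> leaf \<theta>"
  using forms_in_leaf[OF reach assms(1)] steps_decomposed[OF reach] assms(2,3) by metis

lemma RVar_leaf: "Fm u (RVar r) w \<in> forms \<theta> \<Longrightarrow> Fm u (RVar r) w \<in> leaf \<theta>"
  by (rule undecomposable_in_leaf) (auto elim: decomposes.cases)

lemma Neg_RVar_leaf: "Fm u (Neg (RVar r)) w \<in> forms \<theta> \<Longrightarrow> Fm u (Neg (RVar r)) w \<in> leaf \<theta>"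
  by (rule undecomposable_in_leaf) (auto elim: decomposes.cases)

lemma One_not_in_forms: "Fm u One w \<notin> forms \<theta>"
proof
  assume "Fm u One w \<in> forms \<theta>"
  then have "Fm u One w \<in> leaf \<theta>" by (rule undecomposable_in_leaf) (auto elim: decomposes.cases)
  then show False using leaf_nax by (auto simp: axiomatic_set_def)
qed

lemma Comp_leaf: "Fm u (Comp R S) w \<in> forms \<theta> \<Longrightarrow> Fm u (Comp R S) w \<in> leaf \<theta>"
  by (rule undecomposable_in_leaf) (auto elim: decomposes.cases)

lemma literals_consistent: "Fm u (RVar r) w \<in> forms \<theta> \<Longrightarrow> Fm u (Neg (RVar r)) w \<notin> forms \<theta>"
  using RVar_leaf Neg_RVar_leaf leaf_nax by (meson axiomatic_set_def)

lemma Boolean_saturated: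
  assumes \<phi>: "\<phi> \<in> forms \<theta>" and d: "decomposes x y Boolean \<phi> \<Gamma>s"
  shows "\<exists>\<Gamma>s \<Gamma>. decomposes x y Boolean \<phi> \<Gamma>s \<and> \<Gamma> \<in> set \<Gamma>s \<and> \<Gamma> \<subseteq> forms \<theta>"
proof (cases "(Boolean, \<phi>) \<in> set (steps \<theta>)")
  case True then show ?thesis by (rule decomposed_Boolean)
next
  case False
  have "(NegComp z, \<phi>) \<notin> set (steps \<theta>)" for z
    using steps_decomposed[OF reach] decomposes_Boolean_NegComp(1)[OF d] by blast
  then have "\<phi> \<in> leaf \<theta>" using forms_in_leaf[OF reach \<phi>] False by blast
  moreover have "\<not> blocked y \<theta> \<phi>"
    using decomposes_Boolean_NegComp(2)[OF d] by (auto simp: blocked_def)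
  ultimately have "permitted x y \<theta> (Boolean, \<phi>) \<Gamma>s"
    using d False by (simp add: permitted_def applicable_def)
  then show ?thesis using not_permitted by blast
qed

lemma Boolean_rules:
  "Fm u (Cup R S) w \<in> forms \<theta> \<Longrightarrow> Fm u R w \<in> forms \<theta> \<and> Fm u S w \<in> forms \<theta>"
  "Fm u (Neg (Cup R S)) w \<in> forms \<theta> \<Longrightarrow> Fm u (Neg R) w \<in> forms \<theta> \<or> Fm u (Neg S) w \<in> forms \<theta>"
  "Fm u (Cap R S) w \<in> forms \<theta> \<Longrightarrow> Fm u R w \<in> forms \<theta> \<or> Fm u S w \<in> forms \<theta>"
  "Fm u (Neg (Cap R S)) w \<in> forms \<theta> \<Longrightarrow> Fm u (Neg R) w \<in> forms \<theta> \<and> Fm u (Neg S) w \<in> forms \<theta>"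
  "Fm u (Neg (Neg R)) w \<in> forms \<theta> \<Longrightarrow> Fm u R w \<in> forms \<theta>"
  by ((drule Boolean_saturated, rule decomposes.intros, elim exE conjE, (erule decomposes.cases; auto))+)

lemma permitted_imp_step:
  assumes "\<phi> \<in> leaf \<theta>" "decomposes x y r \<phi> \<Gamma>s" "side_condition \<theta> (r, \<phi>)" "\<not> blocked y \<theta> \<phi>"
  shows "repeated \<theta> (r, \<phi>)"
  using not_permitted[of "(r, \<phi>)" \<Gamma>s] assms by (simp add: permitted_def applicable_def)

lemma CompA_saturated:
  assumes "Fm u (Comp B S) y \<in> forms \<theta>" "pos_bool B" "bool_constr (forms \<theta>) (Fm u (Neg B) c)"
  shows "Fm c S y \<in> forms \<theta>"
proof -
  have "repeated \<theta> (CompA c, Fm u (Comp B S) y)"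
    using Comp_leaf assms
    by (intro permitted_imp_step) (auto intro: decomposes.intros simp: V_def blocked_def)
  then have "(CompA c, Fm u (Comp B S) y) \<in> set (steps \<theta>)" by simp
  from steps_decomposed[OF reach this] show ?thesis by (auto elim: decomposes.cases)
qed

lemma CompB_saturated:
  assumes "Fm x (Comp One S) y \<in> forms \<theta>" "c \<in> vars \<theta>"
  shows "Fm c S y \<in> forms \<theta>"
\<comment> \<open>The side condition of \<open>CompB\<close> demands that the conclusion be absent;
  the assumption of the contradiction supplies this.\<close>
proof (rule ccontr)
  assume n: "Fm c S y \<notin> forms \<theta>"
  have "repeated \<theta> (CompB c, Fm x (Comp One S) y)"
    using Comp_leaf assms n
    by (intro permitted_imp_step) (auto intro: decomposes.intros simp: blocked_def)
  then have "(CompB c, Fm x (Comp One S) y) \<in> set (steps \<theta>)" by simp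
  from steps_decomposed[OF reach this] show False using n by (auto elim: decomposes.cases)
qed

lemma fresh_var: "\<exists>z. z \<notin> vars \<theta>"
  using finite_vars[OF reach] ex_new_if_finite infinite_UNIV_nat by blast

lemma Neg_Comp_leaf:
  assumes "Fm u (Neg (Comp R S)) w \<in> forms \<theta>" "\<And>z. (NegComp z, Fm u (Neg (Comp R S)) w) \<notin> set (steps \<theta>)"
  shows "Fm u (Neg (Comp R S)) w \<in> leaf \<theta>"
  using forms_in_leaf[OF reach assms(1)] assms(2) decomposed_Boolean decomposes_Boolean_NegComp(2)
  by blast

text \<open>A branch is finite, so a fresh variable is always at hand; only an earlier application
  or blocking can prevent the decomposition.\<close>

lemma Neg_Comp_saturated:
  assumes f: "Fm u (Neg (Comp B S)) y \<in> forms \<theta>" and B: "pos_bool B"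
  obtains (decomposed) w where "(NegComp w, Fm u (Neg (Comp B S)) y) \<in> set (steps \<theta>)"
  | (blocked) u' w where "blocks_via y \<theta> u' u B S w"
proof (cases "\<exists>w. (NegComp w, Fm u (Neg (Comp B S)) y) \<in> set (steps \<theta>)")
  case False
  obtain z where z: "z \<notin> vars \<theta>" using fresh_var by blast
  obtain \<Gamma>s where d: "decomposes x y (NegComp z) (Fm u (Neg (Comp B S)) y) \<Gamma>s"
    using B decomposes.intros(6,7)[of B] by (cases "S = One") blast+
  \<comment> \<open>This makes the second half of the side condition of \<open>NegComp\<close>,
    which concerns \<open>Comp One S\<close>, vacuous.\<close>
  have "B \<noteq> One" using B by auto
  then have "blocked y \<theta> (Fm u (Neg (Comp B S)) y)"
    using permitted_imp_step[OF _ d] Neg_Comp_leaf[OF f] False z by auto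
  then show thesis using blocked by (auto simp: blocked_def blocks_iff)
qed (use decomposed in blast)

lemma NegComp_step:
  assumes "(NegComp w, Fm u (Neg (Comp B S)) y) \<in> set (steps \<theta>)" "pos_bool B"
  shows "Fm u (Neg B) w \<in> forms \<theta>" "S \<noteq> One \<Longrightarrow> Fm w (Neg S) y \<in> forms \<theta>"
  using steps_decomposed[OF reach assms(1)] assms(2) by (auto elim: decomposes.cases)

text \<open>An introduced variable differs from \<open>y\<close>, so the literal must stem from the
  left argument of a decomposed composition, and \<open>w\<close> was introduced by one step
  only.\<close>

lemma literal_parent:
  assumes f: "Fm u (Neg (RVar r)) w \<in> forms \<theta>" and s: "(NegComp w, \<psi>) \<in> set (steps \<theta>)"
  shows "u = lvar \<psi>"
proof -
  have "w \<noteq> y" using reachable_new_vars[OF reach] s set_new_vars by blast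
  then obtain \<psi>' where "(NegComp w, \<psi>') \<in> set (steps \<theta>)" "lvar \<psi>' = u"
    using reachable_well_shaped[OF P reach f] by (auto simp: well_shaped_def)
  then show ?thesis using NegComp_unique[OF reach _ s] by blast
qed

text \<open>The atoms at a given pair never mix sources: \<open>w\<close> has a single parent, so
  all literals ending in \<open>w\<close> have the same left variable, which is either
  \<open>u\<close> or the blocker of \<open>u\<close>.\<close>

lemma branch_rel_cases:
  obtains (own) "\<And>r. (u, w) \<in> branch_rel y \<theta> r \<Longrightarrow> Fm u (Neg (RVar r)) w \<in> forms \<theta>"
  | (copied) z' B S where "blocks_via y \<theta> z' u B S w"
      "\<And>r. (u, w) \<in> branch_rel y \<theta> r \<Longrightarrow> Fm z' (Neg (RVar r)) w \<in> forms \<theta>"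
proof (cases "\<exists>z' B S. Fm u (Neg (Comp B S)) y \<in> forms \<theta> \<and> blocks_via y \<theta> z' u B S w")
  case False
  then show thesis using own by (auto simp: branch_rel_def)
next
  case True
  then obtain z' B S where b: "blocks_via y \<theta> z' u B S w" by blast
  have st: "(NegComp w, Fm z' (Neg (Comp B S)) y) \<in> set (steps \<theta>)" and ne: "z' \<noteq> u"
    using b by (auto simp: blocks_via_def)
  have "Fm z' (Neg (RVar r)) w \<in> forms \<theta>" if rel: "(u, w) \<in> branch_rel y \<theta> r" for r
  proof -
    have "Fm u (Neg (RVar r)) w \<notin> forms \<theta>" using literal_parent[OF _ st, of u] ne by auto
    then obtain z'' B' S' where "blocks_via y \<theta> z'' u B' S' w" "Fm z'' (Neg (RVar r)) w \<in> forms \<theta>"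
      using rel unfolding branch_rel_def by blast
    then show ?thesis using literal_parent[OF _ st, of z''] by simp
  qed
  then show thesis using copied b by blast
qed

lemma interp_subset: "M R \<subseteq> vars \<theta> \<times> vars \<theta>"
proof -
  have "branch_rel y \<theta> r \<subseteq> vars \<theta> \<times> vars \<theta>" for r
    by (auto simp: branch_rel_def dest: vars_forms)
  then show ?thesis by (induction R) auto
qed

text \<open>The induction is on size because a complemented union or intersection is reduced to
  complements of its arguments, which are smaller but no subterms.\<close>

lemma branch_falsified: "Fm u R w \<in> forms \<theta> \<Longrightarrow> (u, w) \<notin> M R"
proof (induction "size R" arbitrary: u R w rule: less_induct)
  case less
  note f = less.prems
  have uw: "u \<in> vars \<theta>" "w \<in> vars \<theta>" using f vars_forms by blast+
  have IH: "(u', w') \<notin> M R'" if "Fm u' R' w' \<in> forms \<theta>" "size R' < size R" for u' R' w'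
    using less.hyps that by blast
  have sh: "well_shaped x y \<theta> (Fm u R w)" by (rule reachable_well_shaped[OF P reach f])
  show ?case
  proof (cases R)
    case (RVar r)
    have w: "w = y" using sh RVar by (simp add: well_shaped_def)
    have "(u, y) \<notin> branch_rel y \<theta> r"
    proof
      assume "(u, y) \<in> branch_rel y \<theta> r"
      moreover have "Fm u (Neg (RVar r)) y \<notin> forms \<theta>"
        using literals_consistent f RVar w by blast
      \<comment> \<open>A copied pair ends in an introduced variable, and \<open>y\<close> is
        none.\<close>
      ultimately obtain \<psi> where "(NegComp y, \<psi>) \<in> set (steps \<theta>)"
        unfolding branch_rel_def blocks_via_def by blast
      then show False using reachable_new_vars[OF reach] set_new_vars by blast
    qed
    then show ?thesis using RVar w by simp
  next
    case One
    then show ?thesis using f One_not_in_forms by simp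
  next
    case (Cup S T)
    then have "Fm u S w \<in> forms \<theta>" "Fm u T w \<in> forms \<theta>"
      using f Boolean_rules(1)[of u S T w] by auto
    then show ?thesis using IH[of u S w] IH[of u T w] Cup by simp
  next
    case (Cap S T)
    then have "Fm u S w \<in> forms \<theta> \<or> Fm u T w \<in> forms \<theta>"
      using f Boolean_rules(3)[of u S T w] by auto
    then show ?thesis using IH[of u S w] IH[of u T w] Cap by auto
  next
    case (Comp B S)
    then have w: "w = y" and "pos_bool B \<or> u = x \<and> B = One" using sh by (auto simp: well_shaped_def)
    then consider "pos_bool B" | "u = x" "B = One" by blast
    then have "(c, y) \<notin> M S" if c: "c \<in> vars \<theta>" "(u, c) \<in> M B" for c
    proof cases
      case 1
      have "Fm c S y \<in> forms \<theta>"
      proof (cases rule: branch_rel_cases[of u c])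
        case own
        have "bool_constr (forms \<theta>) (Fm u (Neg B) c)" by (rule bool_constr_Neg[OF 1 own c(2)])
        then show ?thesis using CompA_saturated[of u B S c] 1 f Comp w by simp
      next
        case (copied z' B' S')
        \<comment> \<open>Here the blocking condition is used: the copied literals construct the
          complement of \<open>B\<close>, so the blocker \<open>z'\<close> carries the same
          composition, and \<open>CompA\<close> at \<open>z'\<close> gives the same conclusion
          \<open>c S y\<close>.\<close>
        have "bool_constr (copied_literals \<theta> z' u c) (Fm u (Neg B) c)"
          by (rule bool_constr_Neg[OF 1 _ c(2)]) (use copied(2) in \<open>auto simp: copied_literals_def\<close>)
        then have "Fm z' (Comp B S) y \<in> forms \<theta>"
          using copied(1) 1 f Comp w by (auto simp: blocks_via_def)
        moreover have "bool_constr (forms \<theta>) (Fm z' (Neg B) c)"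
          by (rule bool_constr_Neg[OF 1 copied(2) c(2)])
        ultimately show ?thesis using CompA_saturated[of z' B S c] 1 by simp
      qed
      then show ?thesis using IH[of c S y] Comp by simp
    next
      case 2
      then have "Fm c S y \<in> forms \<theta>" using CompB_saturated[of S c] f Comp w c by simp
      then show ?thesis using IH[of c S y] Comp by simp
    qed
    then show ?thesis using Comp w by auto
  next
    case (Neg Q)
    have "(u, w) \<in> M Q"
    proof (cases Q)
      case (RVar r)
      then show ?thesis using f Neg by (simp add: branch_rel_def)
    next
      case One
      then show ?thesis using uw by simp
    next
      case (Cup S T)
      then have "Fm u (Neg S) w \<in> forms \<theta> \<or> Fm u (Neg T) w \<in> forms \<theta>"
        using Neg f Boolean_rules(2)[of u S T w] by auto
      then have "(u, w) \<notin> M (Neg S) \<or> (u, w) \<notin> M (Neg T)"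
        using IH[of u "Neg S" w] IH[of u "Neg T" w] Neg Cup by auto
      then show ?thesis using Cup uw by auto
    next
      case (Cap S T)
      then have "Fm u (Neg S) w \<in> forms \<theta>" "Fm u (Neg T) w \<in> forms \<theta>"
        using Neg f Boolean_rules(4)[of u S T w] by auto
      then have "(u, w) \<notin> M (Neg S)" "(u, w) \<notin> M (Neg T)"
        using IH[of u "Neg S" w] IH[of u "Neg T" w] Neg Cap by auto
      then show ?thesis using Cap uw by auto
    next
      case (Neg S)
      then have "Fm u S w \<in> forms \<theta>"
        using \<open>R = Neg Q\<close> f Boolean_rules(5)[of u S w] by auto
      then show ?thesis using IH[of u S w] \<open>R = Neg Q\<close> Neg uw by simp
    next
      case (Comp B S)
      then have w: "w = y" and "pos_bool B \<or> u = x \<and> B = One" using sh Neg by (auto simp: well_shaped_def)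
      then consider "pos_bool B" | "u = x" "B = One" by blast
      then have "\<exists>c\<in>vars \<theta>. (u, c) \<in> M B \<and> (c, y) \<in> M S"
      proof cases
        case 1
        \<comment> \<open>The left variable is kept arbitrary because the step may belong to
          \<open>u\<close> itself or to its blocker; the induction hypothesis applies to both, as
          the decomposed term is the same.\<close>
        have witness: "c \<in> vars \<theta> \<and> (u', c) \<in> M B \<and> (c, y) \<in> M S"
          if st: "(NegComp c, Fm u' (Neg (Comp B S)) y) \<in> set (steps \<theta>)" for u' c
        proof -
          have uB: "Fm u' (Neg B) c \<in> forms \<theta>" by (rule NegComp_step(1)[OF st 1])
          then have c: "u' \<in> vars \<theta>" "c \<in> vars \<theta>" using vars_forms by blast+
          have "(u', c) \<notin> M (Neg B)" using uB IH[of u' "Neg B" c] Neg Comp by simp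
          moreover have "(c, y) \<notin> M (Neg S)" if "S \<noteq> One"
            using NegComp_step(2)[OF st 1 that] IH[of c "Neg S" y] Neg Comp by simp
          ultimately show ?thesis using c uw w by (cases "S = One") auto
        qed
        have f': "Fm u (Neg (Comp B S)) y \<in> forms \<theta>" using f Neg Comp w by simp
        from f' 1 show ?thesis
        proof (cases rule: Neg_Comp_saturated)
          case (decomposed c)
          then show ?thesis using witness by blast
        next
          case (blocked u' c)
          then have st: "(NegComp c, Fm u' (Neg (Comp B S)) y) \<in> set (steps \<theta>)" and ne: "u' \<noteq> u"
            by (auto simp: blocks_via_def)
          \<comment> \<open>Since \<open>c\<close> was introduced for \<open>u'\<close>, no atom at
            \<open>(u', c)\<close> is itself a copy. Each one comes from a literal and is therefore
            passed on to \<open>u\<close>.\<close>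
          have "Fm u' (Neg (RVar r)) c \<in> forms \<theta>" if "(u', c) \<in> branch_rel y \<theta> r" for r
          proof (cases rule: branch_rel_cases[of u' c])
            case own
            then show ?thesis using that by blast
          next
            case (copied z' B' S')
            then show ?thesis using literal_parent[OF _ st, of z'] that by fastforce
          qed
          then have "(u, c) \<in> branch_rel y \<theta> r" if "(u', c) \<in> branch_rel y \<theta> r" for r
            using that f' blocked unfolding branch_rel_def by blast
          then have "(u, c) \<in> M B"
            using witness[OF st] pos_bool_interp_mono[OF 1, of u' c "branch_rel y \<theta>"] by blast
          then show ?thesis using witness[OF st] by blast
        qed
      next
        case 2
        show ?thesis
        proof (cases "S = One")
          case True
          then show ?thesis using 2 uw w by auto
        next
          case False
          have "\<exists>c. Fm c (Neg S) y \<in> forms \<theta>"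
          proof (cases "\<exists>c. (NegComp c, Fm x (Neg (Comp One S)) y) \<in> set (steps \<theta>)")
            case True
            then obtain c where "(NegComp c, Fm x (Neg (Comp One S)) y) \<in> set (steps \<theta>)" by blast
            from steps_decomposed[OF reach this] have "Fm c (Neg S) y \<in> forms \<theta>"
              using False by (auto elim: decomposes.cases)
            then show ?thesis ..
          next
            case n: False
            obtain z where z: "z \<notin> vars \<theta>" using fresh_var by blast
            have "Fm x (Neg (Comp One S)) y \<in> forms \<theta>" using f 2 Comp Neg w by simp
            \<comment> \<open>As \<open>z\<close> is fresh, the failure means that some introduced
              variable already has the formula with \<open>Neg S\<close>; that variable is the
              witness.\<close>
            then have "\<not> side_condition \<theta> (NegComp z, Fm x (Neg (Comp One S)) y)"
              using permitted_imp_step[OF Neg_Comp_leaf decomposes.intros(8)[OF False, of x y z]] n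
              by (auto simp: blocked_def)
            then show ?thesis using z by auto
          qed
          then obtain c where c: "Fm c (Neg S) y \<in> forms \<theta>" by blast
          then have "(c, y) \<notin> M (Neg S)" using IH[of c "Neg S" y] Neg Comp 2 by simp
          then have "(c, y) \<in> M S" "c \<in> vars \<theta>" using vars_forms[OF c] by auto
          then show ?thesis using 2 uw by auto
        qed
      qed
      then show ?thesis using Comp w by auto
    qed
    then show ?thesis using Neg by simp
  qed
qed

end

text \<open>The countermodels found have variables as elements; an injection moves them into any
  infinite type.\<close>

lemma interp_image:
  assumes f: "inj_on f U" and m: "\<And>r. m r \<subseteq> U \<times> U"
  shows "a \<in> U \<Longrightarrow> b \<in> U \<Longrightarrow>
    (f a, f b) \<in> interp (f ` U) (\<lambda>r. map_prod f f ` m r) R \<longleftrightarrow> (a, b) \<in> interp U m R"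
proof (induction R arbitrary: a b)
  case (RVar r)
  then show ?case
    using inj_on_image_mem_iff[OF map_prod_inj_on[OF f f] _ m, of "(a, b)" r] by simp
qed auto

lemma valid_nat_model:
  fixes m :: "rvar \<Rightarrow> (nat \<times> nat) set"
  assumes "infinite (UNIV :: 'u set)" and v: "valid TYPE('u) \<phi>"
    and m: "\<And>r. m r \<subseteq> U \<times> U" and xy: "lvar \<phi> \<in> U" "rvar \<phi> \<in> U"
  shows "(lvar \<phi>, rvar \<phi>) \<in> interp U m (rel \<phi>)"
proof -
  obtain f :: "nat \<Rightarrow> 'u" where f: "inj f"
    using assms(1) infinite_countable_subset by blast
  then have fU: "inj_on f U" by (rule inj_on_subset) simp
  \<comment> \<open>A valuation must map every object variable into the universe, so variables
    outside \<open>U\<close> take the value of \<open>lvar \<phi>\<close>.\<close>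
  define val where "val z = f (if z \<in> U then z else lvar \<phi>)" for z
  have "is_model (f ` U) (\<lambda>r. map_prod f f ` m r)"
    using m xy by (fastforce simp: is_model_def)
  moreover have "is_valuation (f ` U) val" using xy by (simp add: is_valuation_def val_def)
  ultimately have "satisfies (f ` U) (\<lambda>r. map_prod f f ` m r) val \<phi>"
    using v unfolding valid_def by blast
  then show ?thesis
    using xy by (simp add: satisfies_def val_def interp_image[OF fU m])
qed

lemma open_branch_not_valid:
  assumes "open_branch x y P \<theta>" and inf: "infinite (UNIV :: 'u set)"
  shows "\<not> valid TYPE('u) (Fm x P y)"
proof
  interpret open_branch x y P \<theta> by fact
  assume v: "valid TYPE('u) (Fm x P y)"
  have "branch_rel y \<theta> r \<subseteq> vars \<theta> \<times> vars \<theta>" for r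
    using interp_subset[of "RVar r"] by simp
  then have "(x, y) \<in> M P"
    using valid_nat_model[OF inf v, of "branch_rel y \<theta>" "vars \<theta>"] root_vars[OF reach] by simp
  then show False using branch_falsified[OF root_in_forms[OF reach]] by blast
qed


section \<open>Runs of the procedure\<close>

lemma branch_at_Leaf: "branch_at (Leaf N) q = Some \<theta> \<longleftrightarrow> q = [] \<and> \<theta> = Branch [N] []"
  by (cases q) auto

lemma branch_at_Step:
  "branch_at (Step N b ts) q = Some \<theta> \<longleftrightarrow>
   (\<exists>i p \<theta>'. q = i # p \<and> i < length ts \<and> branch_at (ts ! i) p = Some \<theta>' \<and>
      \<theta> = Branch (N # nodes \<theta>') (b # steps \<theta>'))"
  by (cases q) auto

text \<open>Induction along the path to a leaf: only the child that the path enters has an induction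
  hypothesis, which avoids the nested recursion through lists of subtrees.\<close>

lemma branch_at_induct [consumes 1, case_names Leaf Step]:
  assumes "branch_at t p = Some \<theta>"
    and "\<And>N. Q (Leaf N) [] (Branch [N] [])"
    and "\<And>N b ts i p \<theta>. i < length ts \<Longrightarrow> branch_at (ts ! i) p = Some \<theta> \<Longrightarrow> Q (ts ! i) p \<theta> \<Longrightarrow>
      Q (Step N b ts) (i # p) (Branch (N # nodes \<theta>) (b # steps \<theta>))"
  shows "Q t p \<theta>"
  using assms(1)
proof (induction p arbitrary: t \<theta>)
  case Nil
  then show ?case using assms(2) by (cases t) auto
next
  case (Cons i p)
  then obtain N b ts where t: "t = Step N b ts" by (cases t) auto
  obtain \<theta>' where i: "i < length ts" and \<theta>': "branch_at (ts ! i) p = Some \<theta>'"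
    and \<theta>: "\<theta> = Branch (N # nodes \<theta>') (b # steps \<theta>')"
    using Cons.prems unfolding t branch_at_Step by blast
  show ?case unfolding t \<theta> by (rule assms(3)[OF i \<theta>' Cons.IH[OF \<theta>']])
qed

lemma branch_at_extend_new:
  "branch_at t p = Some \<theta> \<Longrightarrow> j < length Ns \<Longrightarrow>
   branch_at (extend_at t p a Ns) (p @ [j]) = Some (Branch (nodes \<theta> @ [Ns ! j]) (steps \<theta> @ [a]))"
  by (induction rule: branch_at_induct) auto

lemma branch_at_extend:
  "branch_at t p = Some \<theta> \<Longrightarrow> branch_at (extend_at t p a Ns) q = Some \<theta>' \<Longrightarrow>
   branch_at t q = Some \<theta>' \<or>
   (\<exists>j < length Ns. \<theta>' = Branch (nodes \<theta> @ [Ns ! j]) (steps \<theta> @ [a]))"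
proof (induction arbitrary: q \<theta>' rule: branch_at_induct)
  case (Leaf N)
  then show ?case by (auto simp: branch_at_Step branch_at_Leaf)
next
  case (Step N b ts i p \<theta>)
  obtain j q' \<theta>2 where q: "q = j # q'" "j < length ts"
    and \<theta>2: "branch_at (ts[i := extend_at (ts ! i) p a Ns] ! j) q' = Some \<theta>2"
    and \<theta>': "\<theta>' = Branch (N # nodes \<theta>2) (b # steps \<theta>2)"
    using Step.prems unfolding extend_at.simps branch_at_Step length_list_update by blast
  show ?case
  proof (cases "j = i")
    case True
    then have "branch_at (extend_at (ts ! i) p a Ns) q' = Some \<theta>2" using \<theta>2 Step.hyps(1) by simp
    from Step.IH[OF this] show ?thesis
      using \<theta>' q True by auto
  next
    case False
    then show ?thesis using \<theta>2 \<theta>' q by auto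
  qed
qed

lemma branch_at_apply_new:
  assumes "branch_at t p = Some \<theta>" "j < length \<Gamma>s"
  shows "branch_at (apply_at t p \<theta> a \<Gamma>s) (p @ [j]) = Some (extend \<theta> a (\<Gamma>s ! j))"
  unfolding apply_at_def extend_def by (subst branch_at_extend_new[OF assms(1)]) (use assms(2) in simp_all)

lemma branch_at_apply:
  assumes "branch_at t p = Some \<theta>" "branch_at (apply_at t p \<theta> a \<Gamma>s) q = Some \<theta>'"
  shows "branch_at t q = Some \<theta>' \<or> (\<exists>\<Gamma> \<in> set \<Gamma>s. \<theta>' = extend \<theta> a \<Gamma>)"
  using branch_at_extend[OF assms[unfolded apply_at_def]] by (auto simp: extend_def)

lemma branch_at_length: "branch_at t p = Some \<theta> \<Longrightarrow> length (steps \<theta>) = length p"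
  by (induction rule: branch_at_induct) auto

section \<open>A potential for trees of bounded depth\<close>

fun potential :: "nat \<Rightarrow> dtree \<Rightarrow> nat" where
  "potential k (Leaf N) = 3 ^ k"
| "potential k (Step N a ts) = sum_list (map (potential (k - 1)) ts)"

text \<open>A leaf at depth \<open>d\<close> weighs \<open>3 ^ (k - d)\<close>. Above depth
  \<open>k\<close> it is replaced by at most two leaves of a third of its weight each, so the total
  decreases strictly.\<close>

lemma potential_extend:
  "branch_at t p = Some \<theta> \<Longrightarrow> length p < k \<Longrightarrow> length Ns \<le> 2 \<Longrightarrow>
   potential k (extend_at t p a Ns) < potential k t"
proof (induction arbitrary: k rule: branch_at_induct)
  case (Leaf N)
  then obtain l where k: "k = Suc l" by (cases k) auto
  have "potential k (extend_at (Leaf N) [] a Ns) = length Ns * 3 ^ l"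
    by (simp add: k sum_list_triv comp_def)
  also have "\<dots> < 3 * 3 ^ l" using Leaf by simp
  finally show ?case by (simp add: k)
next
  case (Step N b ts i p \<theta>)
  let ?f = "potential (k - 1)"
  have less: "?f (extend_at (ts ! i) p a Ns) < ?f (ts ! i)"
    using Step.IH[of "k - 1"] Step.prems by simp
  have "?f (ts ! i) \<le> sum_list (map ?f ts)"
    using Step.hyps(1) by (intro member_le_sum_list) auto
  then show ?case using less Step.hyps(1) by (simp add: map_update sum_list_update)
qed

section \<open>The invariant of runs\<close>

fun tree_of :: "state \<Rightarrow> dtree" where
  "tree_of (Select t) = t"
| "tree_of (Consider t p) = t"
| "tree_of (Saturate t p z) = t"
| "tree_of (Proved t) = t"
| "tree_of (Open_branch t p) = t"

text \<open>For the two outcomes the condition under which the procedure stopped is kept, so that it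
  is still available once the run is over.\<close>

fun position_ok :: "ovar \<Rightarrow> ovar \<Rightarrow> state \<Rightarrow> bool" where
  "position_ok x y (Select t) = True"
| "position_ok x y (Consider t p) = (branch_at t p \<noteq> None)"
| "position_ok x y (Saturate t p z) = (branch_at t p \<noteq> None)"
| "position_ok x y (Proved t) = closed_tree t"
| "position_ok x y (Open_branch t p) =
     (\<exists>\<theta>. branch_at t p = Some \<theta> \<and> \<not> axiomatic \<theta> \<and> \<not> expandable x y \<theta>)"

definition run_inv :: "ovar \<Rightarrow> rterm \<Rightarrow> ovar \<Rightarrow> state \<Rightarrow> bool" where
  "run_inv x P y s \<longleftrightarrow>
     deduction_tree (Fm x P y) (tree_of s) \<and>
     (\<forall>p \<theta>. branch_at (tree_of s) p = Some \<theta> \<longrightarrow> reachable x P y \<theta>) \<and>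
     position_ok x y s"

lemma run_inv_init: "run_inv x P y (Select (initial_tree (Fm x P y)))"
  by (auto simp: run_inv_def initial_tree_def intro: reachable.init
      deduction_tree.intros(1)[unfolded initial_tree_def] simp: branch_at_Leaf)

lemma run_inv_step:
  assumes "proc_step x y s s'" and inv: "run_inv x P y s"
  shows "run_inv x P y s'"
  using assms(1)
proof (cases rule: proc_step.cases)
  case (expand t p \<theta> z a \<Gamma>s j)
  have r: "reachable x P y \<theta>" and dt: "deduction_tree (Fm x P y) t"
    and all: "\<And>p \<theta>. branch_at t p = Some \<theta> \<Longrightarrow> reachable x P y \<theta>"
    using inv expand by (auto simp: run_inv_def)
  have perm: "permitted x y \<theta> a \<Gamma>s" using expand by (simp add: next_app_def)
  have "\<not> axiomatic_set (leaf \<theta>)"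
    using expand(4) reachable_nodes[OF r] by (auto simp: axiomatic_def leaf_def)
  then have "deduction_tree (Fm x P y) (apply_at t p \<theta> a \<Gamma>s)"
    using perm by (intro deduction_tree.intros(2)[OF dt expand(3)]) (auto simp: permitted_def)
  moreover have "reachable x P y \<theta>'" if "branch_at (apply_at t p \<theta> a \<Gamma>s) q = Some \<theta>'" for q \<theta>'
    using branch_at_apply[OF expand(3) that] all reachable.step[OF r perm] by blast
  ultimately show ?thesis
    using branch_at_apply_new[OF expand(3) expand(6), of a] expand(2) by (auto simp: run_inv_def)
qed (use inv in \<open>auto simp: run_inv_def\<close>)

text \<open>Each cycle of bookkeeping steps passes through an expansion, which lowers the potential.\<close>

fun phase :: "ovar \<Rightarrow> ovar \<Rightarrow> state \<Rightarrow> nat" where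
  "phase x y (Select t) = 3"
| "phase x y (Consider t p) = (if axiomatic (the (branch_at t p)) then 4 else 2)"
| "phase x y (Saturate t p z) =
     (if axiomatic (the (branch_at t p)) \<or> \<not> outstanding x y (the (branch_at t p)) z then 5 else 1)"
| "phase x y (Proved t) = 0"
| "phase x y (Open_branch t p) = 0"

text \<open>\<open>phase\<close> never exceeds 5, so with the factor 6 the loss of potential at an
  expansion outweighs any rise of the phase. All other steps keep the tree and lower the
  phase.\<close>

definition run_measure :: "ovar \<Rightarrow> rterm \<Rightarrow> ovar \<Rightarrow> state \<Rightarrow> nat" where
  "run_measure x P y s = 6 * potential (step_bound P) (tree_of s) + phase x y s"

lemma run_measure_decreases:
  assumes "proc_step x y s s'" and inv: "run_inv x P y s"
  shows "run_measure x P y s' < run_measure x P y s"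
  using assms(1)
proof (cases rule: proc_step.cases)
  case (expand t p \<theta> z a \<Gamma>s j)
  have r: "reachable x P y \<theta>" using inv expand by (auto simp: run_inv_def)
  have perm: "permitted x y \<theta> a \<Gamma>s" and "turn a = z" using expand by (simp_all add: next_app_def)
  then have out: "outstanding x y \<theta> z" unfolding outstanding_def by blast
  have "length (steps (extend \<theta> a (\<Gamma>s ! j))) \<le> step_bound P"
    using length_steps[OF reachable.step[OF r perm nth_mem[OF expand(6)]]] .
  then have "length p < step_bound P" using branch_at_length[OF expand(3)] by simp
  then have "potential (step_bound P) (apply_at t p \<theta> a \<Gamma>s) < potential (step_bound P) t"
    unfolding apply_at_def using decomposes_length[OF permittedD(2)[OF perm]]
    by (intro potential_extend[OF expand(3)]) simp_all
  moreover have "phase x y s = 1" using expand out by simp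
  moreover have "phase x y s' \<le> 5" using expand(2) by simp
  ultimately show ?thesis using expand(1,2) by (simp add: run_measure_def)
qed (auto simp: run_measure_def smallest_outstanding_def)

lemma no_infinite_run:
  assumes "run_inv x P y (\<sigma> 0)"
  shows "\<not> (\<forall>i. proc_step x y (\<sigma> i) (\<sigma> (Suc i)))"
proof
  assume st: "\<forall>i. proc_step x y (\<sigma> i) (\<sigma> (Suc i))"
  have inv: "run_inv x P y (\<sigma> i)" for i
    by (induction i) (use assms st run_inv_step in blast)+
  have "(\<sigma> (Suc i), \<sigma> i) \<in> measure (run_measure x P y)" for i
    using run_measure_decreases inv st by simp
  then show False using wf_measure[of "run_measure x P y"] unfolding wf_iff_no_infinite_down_chain by blast
qed

text \<open>Progress: an expandable branch has a minimal outstanding variable, such a variable has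
  an application of least rank, and every rule has at least one alternative; so only the two
  outcomes are stuck.\<close>

lemma final_state:
  assumes inv: "run_inv x P y s" and fin: "\<nexists>s'. proc_step x y s s'"
  shows "(\<exists>t. s = Proved t) \<or> (\<exists>t p. s = Open_branch t p)"
proof (cases s)
  case (Select t)
  then have "\<exists>s'. proc_step x y s s'"
    using proc_step.select[of t] proc_step.nothing_to_select[of t] unfolding closed_tree_def by blast
  then show ?thesis using fin by blast
next
  case (Consider t p)
  then obtain \<theta> where \<theta>: "branch_at t p = Some \<theta>" and r: "reachable x P y \<theta>"
    using inv by (auto simp: run_inv_def)
  show ?thesis
    using fin proc_step.all_closed[OF \<theta>] next_branch[OF \<theta>] proc_step.open_branch[OF \<theta>]
      choose_variable[OF \<theta>] smallest_outstanding_exists[OF r] Consider by metis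
next
  case (Saturate t p z)
  then obtain \<theta> where \<theta>: "branch_at t p = Some \<theta>" using inv by (auto simp: run_inv_def)
  have o: "\<not> axiomatic \<theta>" "outstanding x y \<theta> z" using fin saturated[OF \<theta>] Saturate by blast+
  then obtain a \<Gamma>s where na: "next_app x y \<theta> z a \<Gamma>s" using next_app_exists by blast
  then have "0 < length \<Gamma>s"
    using decomposes_length permittedD(2) unfolding next_app_def by blast
  then show ?thesis using fin proc_step.expand[OF \<theta> o(1) na] Saturate by blast
qed auto

theorem theorem2:
  fixes x y :: ovar and P :: rterm
  assumes "infinite (UNIV :: 'u set)"
    and "P \<in> RT0"
    and "valid TYPE('u) (Fm x P y)"
  shows "yields_proof_tree (Fm x P y)"
proof -
  have proved: "\<exists>t. s = Proved t \<and> proof_tree (Fm x P y) t"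
    if run: "(proc_step x y)\<^sup>*\<^sup>* (Select (initial_tree (Fm x P y))) s"
      and fin: "\<nexists>s'. proc_step x y s s'" for s
  proof -
    have inv: "run_inv x P y s"
      using run by induction (auto intro: run_inv_init run_inv_step)
    \<comment> \<open>The branch returned would give a countermodel to the valid root
      formula.\<close>
    have "s \<noteq> Open_branch t p" for t p
    proof
      assume s: "s = Open_branch t p"
      then obtain \<theta> where "reachable x P y \<theta>" "\<not> axiomatic \<theta>" "\<not> expandable x y \<theta>"
        using inv by (auto simp: run_inv_def)
      then have "open_branch x y P \<theta>" using assms(2) by unfold_locales
      then show False using open_branch_not_valid[OF _ assms(1)] assms(3) by blast
    qed
    then obtain t where "s = Proved t" using final_state[OF inv fin] by blast
    then show ?thesis using inv by (simp add: run_inv_def proof_tree_def)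
  qed
  show ?thesis
    unfolding yields_proof_tree_def fmla.sel
    using proved no_infinite_run[of x P y] run_inv_init[of x P y] by metis
qed

end
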